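(* Every positive integer $n$ is properly $K$-congruent over some real cubic field $K$. More precisely, for a square-free positive integer $n$ let $\lambda=\lambda(n)$ be the unique real solution of the cubic equation $$32\lambda^3-32\lambda^2+8\lambda+n^2=0.$$ Then the point $P_\lambda=(x_\lambda,y_\lambda)$ with coordinates $$x_\lambda=\frac{1}{4(n^2-16)^2}\Bigl\{256+992n^2+65n^4+(1024-2688n^2-28n^4)\lambda+(1024+1920n^2+4n^4)\lambda^2\Bigr\},$$ $$\begin{aligned}y_\lambda=\frac{1}{32(n^2-16)^3}\Bigl\{&-16384+72704n^2+80960n^4+2868n^6-n^8\\&+(196608-462848n^2-145152n^4-1456n^6)\lambda\\&+(196608+421888n^2+100608n^4+208n^6)\lambda^2\Bigr\}\end{aligned}$$ is a point of infinite order in the Mordell-Weil group $E_n(\mathbb{Q}(\lambda))$ of the elliptic curve $E_n: Y^2=X^3-n^2X$ over $\mathbb{Q}(\lambda)$.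
   Context: Let $K$ be a number field and let $n$ be a positive integer. We say that $n$ is a $K$-congruent number if there exist $a,b,c\in K$ such that $$a^2+b^2=c^2\qquad\text{and}\qquad \tfrac12 ab=n.$$ A $K$-congruent number $n$ is called properly $K$-congruent if this system has infinitely many solutions $(a,b,c)\in K^3$. A real cubic field here means a subfield of $\mathbb{R}$ of degree $3$ over $\mathbb{Q}$. *)

theory Defs
  imports
    Complex_Main
    "HOL-Algebra.Algebraic_Closure_Type"
    "HOL-Algebra.Generated_Fields"
    "HOL-Computational_Algebra.Squarefree"
begin

definition congruent_solutions :: "'a::field_char_0 set \<Rightarrow> nat \<Rightarrow> ('a \<times> 'a \<times> 'a) set" where
  "congruent_solutions K n =
     {(a, b, c). a \<in> K \<and> b \<in> K \<and> c \<in> K \<and> a\<^sup>2 + b\<^sup>2 = c\<^sup>2 \<and> 1 / 2 * a * b = of_nat n}"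

definition congruent_over :: "'a::field_char_0 set \<Rightarrow> nat \<Rightarrow> bool" where
  "congruent_over K n \<longleftrightarrow>
     (\<exists>a\<in>K. \<exists>b\<in>K. \<exists>c\<in>K. a\<^sup>2 + b\<^sup>2 = c\<^sup>2 \<and> 1 / 2 * a * b = of_nat n)"

definition properly_congruent_over :: "'a::field_char_0 set \<Rightarrow> nat \<Rightarrow> bool" where
  "properly_congruent_over K n \<longleftrightarrow>
     congruent_over K n \<and> infinite (congruent_solutions K n)"

abbreviation real_ring :: "real ring" where
  "real_ring \<equiv> ring_of_type_algebra"

definition real_cubic_field :: "real set \<Rightarrow> bool" where
  "real_cubic_field K \<longleftrightarrow> subfield K real_ring \<and> ring.dimension real_ring 3 \<rat> K"

(* Every subfield of the reals contains \<rat>, so this is \<rat>(l). *)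
definition rat_adjoin :: "real \<Rightarrow> real set" where
  "rat_adjoin l = generate_field real_ring {l}"

(* Points of Y^2 = X^3 + a X + b: None is the point at infinity. *)
type_synonym 'a ec_point = "('a \<times> 'a) option"

(* Chord-tangent law. The coefficient b does not enter the formulas. Two points of the
   curve with the same abscissa have equal or opposite ordinates, so once opposite points
   are excluded, x1 = x2 means doubling a point with y1 \<noteq> 0. *)
fun ec_add :: "'a::field \<Rightarrow> 'a ec_point \<Rightarrow> 'a ec_point \<Rightarrow> 'a ec_point" where
  "ec_add a None Q = Q"
| "ec_add a (Some P) None = Some P"
| "ec_add a (Some (x1, y1)) (Some (x2, y2)) =
     (if x1 = x2 \<and> y1 = - y2 then None
      else let m = (if x1 = x2 then (3 * x1\<^sup>2 + a) / (2 * y1) else (y2 - y1) / (x2 - x1));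
               x3 = m\<^sup>2 - x1 - x2
           in Some (x3, m * (x1 - x3) - y1))"

(* Written multiplicatively, as groups are in HOL-Algebra: the multiple m P is P [^] m. *)
definition ec_group :: "'a::field set \<Rightarrow> 'a \<Rightarrow> 'a \<Rightarrow> 'a ec_point monoid" where
  "ec_group K a b =
     \<lparr>carrier = insert None {Some (x, y) | x y. x \<in> K \<and> y \<in> K \<and> y\<^sup>2 = x ^ 3 + a * x + b},
      monoid.mult = ec_add a,
      one = None\<rparr>"

definition congruent_curve :: "nat \<Rightarrow> 'a::field set \<Rightarrow> 'a ec_point monoid" where
  "congruent_curve n K = ec_group K (- (of_nat n)\<^sup>2) 0"

definition infinite_order_in :: "('a, 'b) monoid_scheme \<Rightarrow> 'a \<Rightarrow> bool" where
  "infinite_order_in G P \<longleftrightarrow>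
     P \<in> carrier G \<and> (\<forall>m::nat. m > 0 \<longrightarrow> P [^]\<^bsub>G\<^esub> m \<noteq> \<one>\<^bsub>G\<^esub>)"

definition cubic_root :: "nat \<Rightarrow> real \<Rightarrow> bool" where
  "cubic_root n l \<longleftrightarrow> 32 * l ^ 3 - 32 * l\<^sup>2 + 8 * l + (real n)\<^sup>2 = 0"

definition x_coord :: "real \<Rightarrow> real \<Rightarrow> real" where
  "x_coord n l = 1 / (4 * (n ^ 2 - 16) ^ 2) *
     (256 + 992 * n ^ 2 + 65 * n ^ 4
      + (1024 - 2688 * n ^ 2 - 28 * n ^ 4) * l
      + (1024 + 1920 * n ^ 2 + 4 * n ^ 4) * l ^ 2)"

definition y_coord :: "real \<Rightarrow> real \<Rightarrow> real" where
  "y_coord n l = 1 / (32 * (n ^ 2 - 16) ^ 3) *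
     (- 16384 + 72704 * n ^ 2 + 80960 * n ^ 4 + 2868 * n ^ 6 - n ^ 8
      + (196608 - 462848 * n ^ 2 - 145152 * n ^ 4 - 1456 * n ^ 6) * l
      + (196608 + 421888 * n ^ 2 + 100608 * n ^ 4 + 208 * n ^ 6) * l ^ 2)"

end

theory Submission
  imports Defs
begin

text \<open>
  Let \<open>\<lambda>\<close> be the root of the cubic. Then \<open>\<lambda> = - t\<^sup>2 / 2\<close> for the real \<open>t\<close> with \<open>n = 2 t (1 + t\<^sup>2)\<close>,
  and \<open>P\<^sub>\<lambda>\<close> is the double of the point \<open>(- 4 t\<^sup>2, 4 t\<^sup>2 (1 - t\<^sup>2))\<close>. Extend the 2-adic valuation to
  the reals. If \<open>4\<close> does not divide \<open>n\<close>, then \<open>q = n / x\<close> is divisible by \<open>2\<close> at \<open>P\<^sub>\<lambda>\<close>. Doubling a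
  point turns \<open>q\<close> into \<open>4 q (1 - q\<^sup>2) / (1 + q\<^sup>2)\<^sup>2\<close>, which is \<open>4 q\<close> up to a unit. Hence the points
  \<open>2\<^sup>k P\<^sub>\<lambda>\<close> are pairwise distinct, so \<open>P\<^sub>\<lambda>\<close> has infinite order and there are infinitely many
  triangles.

  Associativity is only needed on the points with \<open>x > 0\<close> and the point at infinity. These are
  parametrised by the lemniscate sine and its derivative, and Euler's addition theorem for this
  function has no exceptional cases over an ordered field.
\<close>

section \<open>Subrings and subfields of a field\<close>

interpretation type_domain: domain "ring_of_type_algebra :: 'a::field ring"
  by (rule field.axioms(1)[OF field_from_type_algebra])

lemma ring_of_type_algebra_simps [simp]:
  "carrier ring_of_type_algebra = UNIV"
  "x \<otimes>\<^bsub>ring_of_type_algebra\<^esub> y = x * y" "x \<oplus>\<^bsub>ring_of_type_algebra\<^esub> y = x + y"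
  "\<one>\<^bsub>ring_of_type_algebra\<^esub> = 1" "\<zero>\<^bsub>ring_of_type_algebra\<^esub> = 0"
  by (simp_all add: ring_of_type_algebra_def)

lemma a_inv_ring_of_type_algebra [simp]: "\<ominus>\<^bsub>ring_of_type_algebra\<^esub> x = - x"
  for x :: "'a::field"
  using type_domain.minus_equality[of "- x" x] by simp

lemma m_inv_ring_of_type_algebra [simp]: "x \<noteq> 0 \<Longrightarrow> inv\<^bsub>ring_of_type_algebra\<^esub> x = inverse x"
  for x :: "'a::field"
  using type_domain.comm_inv_char[of x "inverse x"] by simp

lemma pow_ring_of_type_algebra [simp]: "x [^]\<^bsub>ring_of_type_algebra\<^esub> (k::nat) = x ^ k"
  for x :: "'a::field"
  by (induction k) (simp_all add: mult.commute)

definition polys_over :: "'a::zero set \<Rightarrow> 'a poly set" where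
  "polys_over A = {p. \<forall>i. Polynomial.coeff p i \<in> A}"

lemma pCons_mem_polys_over_iff: "pCons a p \<in> polys_over A \<longleftrightarrow> a \<in> A \<and> p \<in> polys_over A"
  unfolding polys_over_def mem_Collect_eq by (metis coeff_pCons_0 coeff_pCons_Suc not0_implies_Suc)

locale subring_of_field =
  fixes A :: "'a::field set"
  assumes subring: "subring A ring_of_type_algebra"
begin

lemma zero_mem: "0 \<in> A"
  and one_mem: "1 \<in> A"
  and uminus_mem: "x \<in> A \<Longrightarrow> - x \<in> A"
  and add_mem: "x \<in> A \<Longrightarrow> y \<in> A \<Longrightarrow> x + y \<in> A"
  and mult_mem: "x \<in> A \<Longrightarrow> y \<in> A \<Longrightarrow> x * y \<in> A"
  using subringE[OF subring] by auto

lemma diff_mem: "x \<in> A \<Longrightarrow> y \<in> A \<Longrightarrow> x - y \<in> A"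
  using add_mem[of x "- y"] uminus_mem[of y] by simp

lemma power_mem: "x \<in> A \<Longrightarrow> x ^ k \<in> A"
  by (induction k) (use one_mem mult_mem in auto)

lemma of_nat_mem: "of_nat k \<in> A"
  by (induction k) (use zero_mem one_mem add_mem in auto)

lemma of_int_mem: "of_int i \<in> A"
  using of_nat_mem uminus_mem by (cases i rule: int_cases2) auto

lemma numeral_mem: "numeral m \<in> A"
  using of_nat_mem[of "numeral m"] by simp

lemmas mem_intros =
  zero_mem one_mem uminus_mem add_mem diff_mem mult_mem power_mem of_nat_mem numeral_mem

lemma poly_mem:
  assumes "p \<in> polys_over A" "x \<in> A"
  shows "poly p x \<in> A"
  using assms(1)
  by (induction p) (auto simp: pCons_mem_polys_over_iff intro!: mem_intros assms(2))

end

lemma simple_extension_eq_poly_image: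
  fixes x :: "'a::field"
  assumes "subring A ring_of_type_algebra"
  shows "type_domain.simple_extension A x = (\<lambda>p. poly p x) ` polys_over A"
proof (intro equalityI subsetI)
  interpret subring_of_field A by (rule subring_of_field.intro[OF assms])
  fix y assume "y \<in> type_domain.simple_extension A x"
  then show "y \<in> (\<lambda>p. poly p x) ` polys_over A"
  proof (induction rule: type_domain.simple_extension.induct)
    case zero
    show ?case by (intro image_eqI[of _ _ 0]) (auto simp: polys_over_def zero_mem)
  next
    case (lin k1 k2)
    then obtain p where "p \<in> polys_over A" "k1 = poly p x" by blast
    with lin(2) show ?case
      by (intro image_eqI[of _ _ "pCons k2 p"]) (auto simp: pCons_mem_polys_over_iff mult.commute)
  qed
next
  let ?B = "type_domain.simple_extension A x"
  interpret B: subring_of_field ?B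
    using type_domain.simple_extension_is_subring[OF assms] by (intro subring_of_field.intro) simp
  have "A \<subseteq> ?B" "x \<in> ?B"
    using type_domain.simple_extension_incl type_domain.simple_extension_mem[OF assms] by auto
  fix y assume "y \<in> (\<lambda>p. poly p x) ` polys_over A"
  then obtain p where "p \<in> polys_over A" and y_eq: "y = poly p x" by blast
  then have "p \<in> polys_over ?B" using \<open>A \<subseteq> ?B\<close> by (auto simp: polys_over_def)
  then show "y \<in> ?B" unfolding y_eq using \<open>x \<in> ?B\<close> by (rule B.poly_mem)
qed

lemma subring_Union_chain:
  fixes \<C> :: "'a::field set set"
  assumes "\<C> \<noteq> {}" and subring: "\<And>B. B \<in> \<C> \<Longrightarrow> subring B ring_of_type_algebra"
    and chain: "\<And>B C. B \<in> \<C> \<Longrightarrow> C \<in> \<C> \<Longrightarrow> B \<subseteq> C \<or> C \<subseteq> B"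
  shows "subring (\<Union>\<C>) ring_of_type_algebra"
proof (rule type_domain.subringI)
  note subring_of_field = subring_of_field.intro[OF subring]
  show "\<one>\<^bsub>ring_of_type_algebra\<^esub> \<in> \<Union>\<C>"
    using \<open>\<C> \<noteq> {}\<close> subring_of_field.one_mem[OF subring_of_field] by auto
  show "\<ominus>\<^bsub>ring_of_type_algebra\<^esub> x \<in> \<Union>\<C>" if "x \<in> \<Union>\<C>" for x
    using that subring_of_field.uminus_mem[OF subring_of_field] by auto
  fix x y assume "x \<in> \<Union>\<C>" "y \<in> \<Union>\<C>"
  then obtain B where B: "B \<in> \<C>" "x \<in> B" "y \<in> B"
    using chain by blast
  interpret subring_of_field B by (rule subring_of_field[OF B(1)])
  show "x \<otimes>\<^bsub>ring_of_type_algebra\<^esub> y \<in> \<Union>\<C>" "x \<oplus>\<^bsub>ring_of_type_algebra\<^esub> y \<in> \<Union>\<C>"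
    using B(1) mult_mem[OF B(2,3)] add_mem[OF B(2,3)] by auto
qed simp

locale subfield_of_field =
  fixes K :: "'a::field_char_0 set"
  assumes subfield: "subfield K ring_of_type_algebra"
begin

sublocale subring_of_field K
  by (rule subring_of_field.intro[OF subfieldE(1)[OF subfield]])

lemma divide_mem:
  assumes "x \<in> K" "y \<in> K"
  shows "x / y \<in> K"
proof -
  have "inverse y \<in> K"
    using type_domain.subfield_m_inv(1)[OF subfield, of y] assms(2) zero_mem by (cases "y = 0") auto
  then show ?thesis using assms(1) mult_mem by (simp add: divide_inverse)
qed

lemma Rats_subset: "\<rat> \<subseteq> K"
  by (auto elim!: Rats_cases' intro: divide_mem of_int_mem)

lemmas field_mem_intros = mem_intros divide_mem

end

lemma subring_Ints: "subring \<int> (ring_of_type_algebra :: 'a::field ring)"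
  by (rule type_domain.subringI) auto

lemma half_notin_Ints: "inverse 2 \<notin> (\<int> :: 'a::field_char_0 set)"
proof
  assume "inverse 2 \<in> (\<int> :: 'a set)"
  then obtain i where "inverse 2 = (of_int i :: 'a)" by (elim Ints_cases)
  then have "(of_int (2 * i) :: 'a) = of_int 1" by (simp add: inverse_eq_divide field_simps)
  then have "2 * i = 1" by (simp only: of_int_eq_iff)
  then show False by presburger
qed

lemma subfield_Rats: "subfield \<rat> (ring_of_type_algebra :: 'a::field_char_0 ring)"
  by (rule field.subfieldI'[OF field_from_type_algebra]) (auto intro: type_domain.subringI)

section \<open>Cubic extensions\<close>

lemma (in domain) linear_factor_imp_root:
  assumes subfield: "subfield K R" and polys: "u \<in> carrier (K[X])" "v \<in> carrier (K[X])"
    and "length u = 2"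
  shows "\<exists>a\<in>K. eval (u \<otimes>\<^bsub>K[X]\<^esub> v) a = \<zero>"
proof
  define a where "a = \<ominus> (inv (hd u) \<otimes> const_term u)"
  show "a \<in> K"
    using degree_one_root(2)[OF subfield polys(1)] \<open>length u = 2\<close>
      subringE(5)[OF subfieldE(1)[OF subfield]]
    by (simp add: a_def)
  then have "a \<in> carrier R" using subfieldE(3)[OF subfield] by blast
  have "eval u a = \<zero>"
    using degree_one_root(1)[OF subfield polys(1)] \<open>length u = 2\<close> by (simp add: a_def)
  moreover have "eval v a \<in> carrier R"
    using eval_in_carrier[OF polynomial_in_carrier[OF subfieldE(1)[OF subfield]] \<open>a \<in> carrier R\<close>]
      polys(2)
    by (simp add: univ_poly_carrier)
  ultimately show "eval (u \<otimes>\<^bsub>K[X]\<^esub> v) a = \<zero>"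
    using ring_hom_memE(2)[OF eval_is_hom[OF subfieldE(1)[OF subfield] \<open>a \<in> carrier R\<close>] polys]
    by simp
qed

lemma (in domain) length_Irr_cubic:
  assumes subfield: "subfield K R" and x: "x \<in> carrier R"
    and cubic: "p \<in> carrier (K[X])" "length p = 4" "eval p x = \<zero>"
    and no_root: "\<And>a. a \<in> K \<Longrightarrow> eval p a \<noteq> \<zero>"
  shows "(algebraic over K) x" "length (Irr K x) = 4"
proof -
  have "p \<noteq> []" using cubic(2) by auto
  then show alg: "(algebraic over K) x" using algebraicI cubic by blast
  note Irr = IrrE[OF subfield x alg]
  interpret UP: cring "K[X]" using univ_poly_is_cring[OF subfieldE(1)[OF subfield]] .
  obtain q where factor: "q \<in> carrier (K[X])" "p = Irr K x \<otimes>\<^bsub>K[X]\<^esub> q"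
    using Irr_minimal[OF subfield x alg cubic(1,3)] pdivides_iff_shell[OF subfield Irr(1) cubic(1)]
    by (auto simp: factor_def)
  have "Irr K x \<noteq> []" "q \<noteq> []"
    using factor \<open>p \<noteq> []\<close> Irr(1) UP.l_null UP.r_null unfolding univ_poly_zero by metis+
  then have "length (Irr K x) - 1 + (length q - 1) = 3"
    using poly_mult_degree_eq[OF subfieldE(1)[OF subfield], of "Irr K x" q] factor Irr(1) cubic(2)
    by (simp add: univ_poly_mult univ_poly_carrier)
  moreover have "length (Irr K x) - 1 \<ge> 1"
    using pirreducible_degree[OF subfield Irr(1,2)] .
  moreover have "length (Irr K x) \<noteq> 2" "length q \<noteq> 2"
    using linear_factor_imp_root[OF subfield Irr(1) factor(1)]
      linear_factor_imp_root[OF subfield factor(1) Irr(1)]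
      no_root factor(2) UP.m_comm[OF Irr(1) factor(1)] by auto
  ultimately show "length (Irr K x) = 4" by linarith
qed

lemma generate_field_eq_simple_extension:
  fixes x :: "'a::field_char_0"
  assumes "(type_domain.algebraic over \<rat>) x"
  shows "generate_field ring_of_type_algebra {x} = type_domain.simple_extension \<rat> x"
proof (rule field.generate_fieldI[OF field_from_type_algebra, symmetric])
  show "subfield (type_domain.simple_extension \<rat> x) ring_of_type_algebra"
    using type_domain.simple_extension_is_subfield[OF subfield_Rats, THEN iffD2] assms by simp
  show "{x} \<subseteq> type_domain.simple_extension \<rat> x"
    using type_domain.simple_extension_mem[OF subfieldE(1)[OF subfield_Rats]] by simp
  fix L assume L: "subfield L (ring_of_type_algebra :: 'a ring)" "{x} \<subseteq> L"
  interpret subfield_of_field L by (rule subfield_of_field.intro[OF L(1)])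
  show "type_domain.simple_extension \<rat> x \<subseteq> L"
    using type_domain.simple_extension_subring_incl[OF subring Rats_subset] L(2) by blast
qed simp

lemma subfield_rat_adjoin: "subfield (rat_adjoin x) real_ring"
  and self_mem_rat_adjoin: "x \<in> rat_adjoin x"
  and rat_adjoin_subset: "subfield L real_ring \<Longrightarrow> x \<in> L \<Longrightarrow> rat_adjoin x \<subseteq> L"
  using field.generate_fieldE[OF field_from_type_algebra, of "{x}" "rat_adjoin x"]
  by (auto simp: rat_adjoin_def)

lemma real_cubic_field_rat_adjoin:
  assumes coeffs: "p \<in> \<rat>" "q \<in> \<rat>" "r \<in> \<rat>" and root: "x ^ 3 + p * x\<^sup>2 + q * x + r = 0"
    and no_root: "\<And>s. s \<in> \<rat> \<Longrightarrow> s ^ 3 + p * s\<^sup>2 + q * s + r \<noteq> 0"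
  shows "real_cubic_field (rat_adjoin x)"
proof -
  let ?p = "[1, p, q, r]"
  have eval: "type_domain.eval ?p s = s ^ 3 + p * s\<^sup>2 + q * s + r" for s
    by (simp add: power2_eq_square power3_eq_cube)
  have "?p \<in> carrier (\<rat> [X]\<^bsub>real_ring\<^esub>)"
    using coeffs by (auto simp: univ_poly_def polynomial_def)
  note Irr = type_domain.length_Irr_cubic[OF subfield_Rats _ this, of x]
  have alg: "(type_domain.algebraic over \<rat>) x" and length_Irr: "length (type_domain.Irr \<rat> x) = 4"
    using Irr root no_root by (auto simp: eval simp del: type_domain.eval.simps)
  show ?thesis
    using type_domain.dimension_simple_extension[OF subfield_Rats _ alg] subfield_rat_adjoin[of x]
    by (simp add: generate_field_eq_simple_extension[OF alg] length_Irr real_cubic_field_def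
        rat_adjoin_def)
qed

section \<open>Valuation rings\<close>

locale valuation_ring = subring_of_field V for V :: "'a::field set" +
  assumes mem_or_inverse_mem: "x \<in> V \<or> inverse x \<in> V"
begin

lemma one_plus_nonunit_nonzero:
  assumes "inverse x \<notin> V" "c \<in> V"
  shows "1 + x * c \<noteq> 0"
proof
  assume "1 + x * c = 0"
  then have "x * (- c) = 1" by (simp add: add_eq_0_iff2)
  then have "inverse x = - c" by (rule inverse_unique)
  then show False using assms uminus_mem by simp
qed

lemma inverse_one_plus_nonunit_mem:
  assumes nonunit: "inverse x \<notin> V" and c_mem: "c \<in> V"
  shows "inverse (1 + x * c) \<in> V"
proof -
  have "x \<noteq> 0" using nonunit zero_mem by auto
  have "x / (1 + x * c) \<in> V"
  proof (rule ccontr)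
    assume "x / (1 + x * c) \<notin> V"
    then have "(1 + x * c) / x \<in> V"
      using mem_or_inverse_mem[of "x / (1 + x * c)"] by simp
    moreover have "inverse x = (1 + x * c) / x - c"
      using \<open>x \<noteq> 0\<close> by (simp add: field_simps)
    ultimately show False using nonunit c_mem diff_mem by metis
  qed
  moreover have "inverse (1 + x * c) = 1 - c * (x / (1 + x * c))"
    using one_plus_nonunit_nonzero[OF assms] by (simp add: field_simps)
  ultimately show ?thesis using c_mem one_mem mult_mem diff_mem by metis
qed

end

locale maximal_subring_without_inverse = subring_of_field A for A :: "'a::field set" +
  fixes \<pi> :: 'a
  assumes pi_mem: "\<pi> \<in> A" and inverse_pi_notin: "inverse \<pi> \<notin> A"
    and maximal: "subring B ring_of_type_algebra \<Longrightarrow> A \<subseteq> B \<Longrightarrow> inverse \<pi> \<notin> B \<Longrightarrow> B = A"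
begin

lemma pi_mult_neq_1: "a \<in> A \<Longrightarrow> \<pi> * a \<noteq> 1"
  using inverse_unique[of \<pi> a] inverse_pi_notin by metis

lemma obtain_poly_if_notin:
  assumes "x \<notin> A"
  obtains f where "f \<in> polys_over A" "\<pi> * poly f x = 1"
proof -
  let ?B = "type_domain.simple_extension A x"
  have "subring ?B ring_of_type_algebra" "A \<subseteq> ?B" "x \<in> ?B"
    using type_domain.simple_extension_is_subring[OF subring] type_domain.simple_extension_incl
      type_domain.simple_extension_mem[OF subring] by auto
  then have "inverse \<pi> \<in> ?B" using maximal assms by metis
  then obtain f where "f \<in> polys_over A" "inverse \<pi> = poly f x"
    unfolding simple_extension_eq_poly_image[OF subring] by blast
  moreover have "\<pi> \<noteq> 0" using inverse_pi_notin zero_mem by auto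
  ultimately show thesis using that by (metis right_inverse)
qed

lemma power_one_plus_pi_mult:
  assumes "a \<in> A"
  shows "\<exists>c\<in>A. (1 + \<pi> * a) ^ k = 1 + \<pi> * c"
proof (induction k)
  case 0
  show ?case using zero_mem by auto
next
  case (Suc k)
  then obtain c where c_power: "c \<in> A" "(1 + \<pi> * a) ^ k = 1 + \<pi> * c" by blast
  then have "(1 + \<pi> * a) ^ Suc k = 1 + \<pi> * (a + c + \<pi> * a * c)"
    by (simp add: algebra_simps)
  moreover have "a + c + \<pi> * a * c \<in> A"
    by (intro mem_intros assms c_power(1) pi_mem)
  ultimately show ?case by blast
qed

lemma inverse_one_plus_pi_mult_mem:
  assumes "a \<in> A"
  shows "inverse (1 + \<pi> * a) \<in> A"
proof (rule ccontr)
  assume notin: "inverse (1 + \<pi> * a) \<notin> A"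
  then have nonzero: "1 + \<pi> * a \<noteq> 0" using zero_mem by auto
  obtain f where f_value: "f \<in> polys_over A" "\<pi> * poly f (inverse (1 + \<pi> * a)) = 1"
    using obtain_poly_if_notin[OF notin] .
  define b where "b = poly (reflect_poly f) (1 + \<pi> * a)"
  have "reflect_poly f \<in> polys_over A"
    using f_value(1) zero_mem by (auto simp: polys_over_def coeff_reflect_poly)
  then have "b \<in> A"
    unfolding b_def by (intro poly_mem mem_intros assms pi_mem)
  obtain c where "c \<in> A" and c_power: "(1 + \<pi> * a) ^ Polynomial.degree f = 1 + \<pi> * c"
    using power_one_plus_pi_mult[OF assms] by blast
  have "\<pi> * b = (1 + \<pi> * a) ^ Polynomial.degree f * (\<pi> * poly f (inverse (1 + \<pi> * a)))"
    unfolding b_def poly_reflect_poly_nz[OF nonzero] by (simp add: mult_ac)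
  then have "\<pi> * (b - c) = 1"
    by (simp add: f_value(2) c_power algebra_simps)
  then show False using pi_mult_neq_1 \<open>b \<in> A\<close> \<open>c \<in> A\<close> diff_mem by blast
qed

lemma obtain_power_as_lower_degree_poly:
  assumes "x \<noteq> 0" and g_value: "g \<in> polys_over A" "\<pi> * poly g (inverse x) = 1"
  obtains h where "h \<in> polys_over A" "\<pi> * poly h x = x ^ Polynomial.degree g"
    "\<And>i. i \<ge> Polynomial.degree g \<Longrightarrow> Polynomial.coeff h i = 0"
proof
  define l b where "l = Polynomial.degree g" and "b = Polynomial.coeff g 0"
  have b_mem: "b \<in> A" using g_value(1) by (simp add: b_def polys_over_def)
  define u where "u = inverse (1 - \<pi> * b)"
  have u_inverse: "u \<in> A" "u * (1 - \<pi> * b) = 1"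
    using inverse_one_plus_pi_mult_mem[of "- b"] pi_mult_neq_1[OF b_mem] b_mem uminus_mem
    by (simp_all add: u_def)
  define h where "h = smult u (reflect_poly g - monom b l)"
  show "h \<in> polys_over A"
    using g_value(1) b_mem u_inverse(1)
    by (auto simp: h_def polys_over_def coeff_reflect_poly intro!: mem_intros)
  have "\<pi> * poly h x = u * (x ^ l * (\<pi> * poly g (inverse x)) - \<pi> * b * x ^ l)"
    by (simp add: h_def poly_reflect_poly_nz[OF \<open>x \<noteq> 0\<close>] poly_monom l_def algebra_simps)
  also have "\<dots> = u * (1 - \<pi> * b) * x ^ l"
    by (simp add: g_value(2) algebra_simps)
  finally show "\<pi> * poly h x = x ^ Polynomial.degree g" by (simp add: u_inverse(2) l_def)
  show "Polynomial.coeff h i = 0" if "i \<ge> Polynomial.degree g" for i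
    using that by (auto simp: h_def b_def l_def coeff_reflect_poly)
qed

lemma obtain_smaller_degree:
  assumes f_value: "f \<in> polys_over A" "\<pi> * poly f x = 1"
    and g_value: "g \<in> polys_over A" "\<pi> * poly g (inverse x) = 1"
    and degree_le: "Polynomial.degree g \<le> Polynomial.degree f" and "x \<noteq> 0"
  obtains f' where "f' \<in> polys_over A" "\<pi> * poly f' x = 1"
    "Polynomial.degree f' < Polynomial.degree f"
proof -
  define m l where "m = Polynomial.degree f" and "l = Polynomial.degree g"
  define a where "a = Polynomial.coeff f m"
  have a_mem: "a \<in> A" using f_value(1) by (simp add: a_def polys_over_def)
  obtain h where h_value: "h \<in> polys_over A" "\<pi> * poly h x = x ^ l"
    and coeff_h: "\<And>i. i \<ge> l \<Longrightarrow> Polynomial.coeff h i = 0"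
    using obtain_power_as_lower_degree_poly[OF \<open>x \<noteq> 0\<close> g_value] unfolding l_def by blast
  define f' where "f' = f - monom a m + smult (\<pi> * a) (monom 1 (m - l) * h)"
  show thesis
  proof (rule that)
    show "f' \<in> polys_over A"
      using f_value(1) h_value(1) a_mem pi_mem
      by (auto simp: f'_def polys_over_def coeff_monom_mult intro!: mem_intros)
    have "x ^ (m - l) * x ^ l = x ^ m" using degree_le by (simp add: m_def l_def flip: power_add)
    moreover have "\<pi> * poly f' x =
        \<pi> * poly f x - \<pi> * a * x ^ m + \<pi> * a * (x ^ (m - l) * (\<pi> * poly h x))"
      by (simp add: f'_def poly_monom algebra_simps)
    ultimately show "\<pi> * poly f' x = 1"
      by (simp add: f_value(2) h_value(2))
    have "m > 0"
    proof (rule ccontr)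
      assume "\<not> m > 0"
      then have "poly f x = a" by (auto simp: a_def m_def elim!: degree_eq_zeroE)
      then show False using f_value(2) pi_mult_neq_1 a_mem by simp
    qed
    moreover have "Polynomial.coeff f' i = 0" if "i \<ge> m" for i
      using that degree_le coeff_h[of "i - (m - l)"]
      by (auto simp: f'_def a_def m_def l_def coeff_monom_mult coeff_eq_0)
    ultimately show "Polynomial.degree f' < Polynomial.degree f"
      unfolding m_def[symmetric] by (intro degree_lessI) auto
  qed
qed

text \<open>If neither \<open>x\<close> nor \<open>1 / x\<close> lay in \<open>A\<close>, then \<open>1 / \<pi>\<close> would be a polynomial over \<open>A\<close> in each of
  them. Of two such polynomials of minimal degree, the longer one can be shortened by the other.\<close>

lemma valuation_ring: "valuation_ring A"
proof (intro valuation_ring.intro valuation_ring_axioms.intro subring_of_field_axioms)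
  fix x :: 'a
  show "x \<in> A \<or> inverse x \<in> A"
  proof (rule ccontr)
    assume "\<not> (x \<in> A \<or> inverse x \<in> A)"
    then have notin: "x \<notin> A" "inverse x \<notin> A" and "x \<noteq> 0" using zero_mem by auto
    let ?P = "\<lambda>y f. f \<in> polys_over A \<and> \<pi> * poly f y = 1"
    obtain f where f_minimal: "?P x f" "\<And>f'. ?P x f' \<Longrightarrow> Polynomial.degree f \<le> Polynomial.degree f'"
      using obtain_poly_if_notin[OF notin(1)] ex_has_least_nat[of "?P x"] by metis
    obtain g where g_minimal: "?P (inverse x) g"
      "\<And>g'. ?P (inverse x) g' \<Longrightarrow> Polynomial.degree g \<le> Polynomial.degree g'"
      using obtain_poly_if_notin[OF notin(2)] ex_has_least_nat[of "?P (inverse x)"] by metis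
    show False
    proof (cases "Polynomial.degree g \<le> Polynomial.degree f")
      case True
      obtain f' where "?P x f'" "Polynomial.degree f' < Polynomial.degree f"
        using obtain_smaller_degree[of f x g] f_minimal(1) g_minimal(1) True \<open>x \<noteq> 0\<close> by blast
      then show ?thesis using f_minimal(2) leD by blast
    next
      case False
      obtain g' where "?P (inverse x) g'" "Polynomial.degree g' < Polynomial.degree g"
        using obtain_smaller_degree[of g "inverse x" f] f_minimal(1) g_minimal(1) False \<open>x \<noteq> 0\<close>
        by auto
      then show ?thesis using g_minimal(2) leD by blast
    qed
  qed
qed

end

theorem chevalley_extension:
  fixes A :: "'a::field set"
  assumes subring: "subring A ring_of_type_algebra" "\<pi> \<in> A" "inverse \<pi> \<notin> A"
  obtains V where "valuation_ring V" "A \<subseteq> V" "inverse \<pi> \<notin> V"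
proof -
  define \<A> where "\<A> = {B. subring B ring_of_type_algebra \<and> A \<subseteq> B \<and> inverse \<pi> \<notin> B}"
  have "\<exists>V\<in>\<A>. \<forall>B\<in>\<A>. V \<subseteq> B \<longrightarrow> B = V"
  proof (rule subset_Zorn_nonempty)
    show "\<A> \<noteq> {}" using subring by (auto simp: \<A>_def)
    fix \<C> assume "\<C> \<noteq> {}" "subset.chain \<A> \<C>"
    then show "\<Union>\<C> \<in> \<A>"
      using subring_Union_chain[of \<C>] by (auto simp: \<A>_def subset_chain_def)
  qed
  then obtain V where V_maximal: "V \<in> \<A>" "\<And>B. B \<in> \<A> \<Longrightarrow> V \<subseteq> B \<Longrightarrow> B = V" by metis
  interpret maximal_subring_without_inverse V \<pi>
    using subring(2) V_maximal
    by (intro maximal_subring_without_inverse.intro subring_of_field.intro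
        maximal_subring_without_inverse_axioms.intro) (auto simp: \<A>_def)
  show thesis
    using that[OF valuation_ring] V_maximal(1) by (auto simp: \<A>_def)
qed

section \<open>Doubling in a dyadic valuation ring\<close>

text \<open>The effect of doubling a point of \<open>y\<^sup>2 = x\<^sup>3 - N\<^sup>2 x\<close> on the ratio \<open>q = N / x\<close>.\<close>

definition double_ratio :: "'a::field \<Rightarrow> 'a" where
  "double_ratio q = 4 * q * (1 - q\<^sup>2) / (1 + q\<^sup>2)\<^sup>2"

text \<open>The ratio \<open>n / x\<close> at the point \<open>P\<^sub>\<lambda>\<close> with \<open>n = 2 t\<^sup>3 + 2 t\<close> and \<open>\<lambda> = - t\<^sup>2 / 2\<close>.\<close>

definition parameter_ratio :: "'a::field \<Rightarrow> 'a" where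
  "parameter_ratio t = 8 * t * (1 + t\<^sup>2) * (1 - t\<^sup>2)\<^sup>2 / (t ^ 4 + 6 * t\<^sup>2 + 1)\<^sup>2"

lemma parameter_ratio_inverse:
  assumes "t \<noteq> 0"
  shows "parameter_ratio (inverse t) = parameter_ratio t"
proof -
  have "inverse t ^ 4 + 6 * (inverse t)\<^sup>2 + 1 = (t ^ 4 + 6 * t\<^sup>2 + 1) / t ^ 4"
    "1 + (inverse t)\<^sup>2 = (1 + t\<^sup>2) / t\<^sup>2" "1 - (inverse t)\<^sup>2 = - (1 - t\<^sup>2) / t\<^sup>2"
    using assms by (simp_all add: field_simps power2_eq_square power4_eq_xxxx)
  moreover have "8 * inverse t * (a / t\<^sup>2) * (- b / t\<^sup>2)\<^sup>2 / (c / t ^ 4)\<^sup>2 =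
      8 * t * a * b\<^sup>2 / c\<^sup>2" for a b c
    using assms by (cases "c = 0") (simp_all add: field_simps power2_eq_square power4_eq_xxxx)
  ultimately show ?thesis by (simp only: parameter_ratio_def)
qed

locale dyadic_valuation_ring = valuation_ring V for V :: "'a::field_char_0 set" +
  assumes half_notin: "inverse 2 \<notin> V"
begin

lemma two_mult_neq_1: "c \<in> V \<Longrightarrow> 2 * c \<noteq> 1"
  using inverse_unique[of 2 c] half_notin by metis

lemmas one_plus_even_nonzero = one_plus_nonunit_nonzero[OF half_notin]
lemmas inverse_one_plus_even_mem = inverse_one_plus_nonunit_mem[OF half_notin]

lemma double_ratio_even:
  assumes c_mem: "c \<in> V" and "c \<noteq> 0"
  shows "double_ratio (2 * c) \<noteq> 0" and "\<exists>v\<in>V. double_ratio (2 * c) = 4 * (2 * c) * v"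
proof -
  have square: "2 * c\<^sup>2 \<in> V" "- (2 * c\<^sup>2) \<in> V" by (intro mem_intros c_mem)+
  have plus: "1 + (2 * c)\<^sup>2 \<noteq> 0" "inverse (1 + (2 * c)\<^sup>2) \<in> V"
    using one_plus_even_nonzero[OF square(1)] inverse_one_plus_even_mem[OF square(1)]
    by (simp_all add: power_mult_distrib)
  have "1 - (2 * c)\<^sup>2 \<noteq> 0"
    using one_plus_even_nonzero[OF square(2)] by (simp add: power_mult_distrib)
  then show "double_ratio (2 * c) \<noteq> 0"
    using plus(1) \<open>c \<noteq> 0\<close> by (simp add: double_ratio_def)
  have "double_ratio (2 * c) = 4 * (2 * c) * ((1 - (2 * c)\<^sup>2) * (inverse (1 + (2 * c)\<^sup>2))\<^sup>2)"
    by (simp add: double_ratio_def divide_inverse power_inverse mult.assoc)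
  moreover have "(1 - (2 * c)\<^sup>2) * (inverse (1 + (2 * c)\<^sup>2))\<^sup>2 \<in> V"
    by (intro mem_intros c_mem plus)
  ultimately show "\<exists>v\<in>V. double_ratio (2 * c) = 4 * (2 * c) * v" by blast
qed

lemma funpow_double_ratio_even:
  assumes "c \<in> V" "c \<noteq> 0"
  obtains d where "d \<in> V" "d \<noteq> 0" "(double_ratio ^^ k) (2 * c) = 2 * d"
proof (induction k arbitrary: thesis)
  case 0
  then show ?case using assms by simp
next
  case (Suc k)
  obtain d where d_ratio: "d \<in> V" "d \<noteq> 0" "(double_ratio ^^ k) (2 * c) = 2 * d"
    by (rule Suc.IH)
  obtain v where v_double: "v \<in> V" "double_ratio (2 * d) = 4 * (2 * d) * v"
    using double_ratio_even(2)[OF d_ratio(1,2)] by blast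
  show ?case
  proof (rule Suc.prems)
    show "4 * d * v \<in> V" by (intro mem_intros d_ratio v_double)
    show "4 * d * v \<noteq> 0" using double_ratio_even(1)[OF d_ratio(1,2)] v_double(2) by auto
    show "(double_ratio ^^ Suc k) (2 * c) = 2 * (4 * d * v)" using d_ratio(3) v_double(2) by simp
  qed
qed

lemma funpow_double_ratio_add:
  assumes "c \<in> V" "c \<noteq> 0"
  shows "\<exists>v\<in>V. (double_ratio ^^ (j + i)) (2 * c) = 4 ^ i * (double_ratio ^^ j) (2 * c) * v"
proof (induction i)
  case 0
  show ?case using one_mem by auto
next
  case (Suc i)
  then obtain v where v_ratio: "v \<in> V"
    "(double_ratio ^^ (j + i)) (2 * c) = 4 ^ i * (double_ratio ^^ j) (2 * c) * v"
    by blast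
  obtain d where d_ratio: "d \<in> V" "d \<noteq> 0" "(double_ratio ^^ (j + i)) (2 * c) = 2 * d"
    using funpow_double_ratio_even[OF assms] .
  then obtain v' where v_double: "v' \<in> V" "double_ratio (2 * d) = 4 * (2 * d) * v'"
    using double_ratio_even(2) by blast
  have "(double_ratio ^^ (j + Suc i)) (2 * c) = 4 * (double_ratio ^^ (j + i)) (2 * c) * v'"
    using v_double(2) by (simp add: d_ratio(3))
  also have "\<dots> = 4 ^ Suc i * (double_ratio ^^ j) (2 * c) * (v * v')"
    unfolding v_ratio(2) by (simp add: mult_ac)
  finally show ?case using v_ratio(1) v_double(1) mult_mem by blast
qed

lemma inj_funpow_double_ratio:
  assumes "c \<in> V" "c \<noteq> 0"
  shows "inj (\<lambda>k. (double_ratio ^^ k) (2 * c))"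
proof (rule linorder_injI)
  fix j k :: nat assume "j < k"
  then obtain i where k_eq: "k = j + Suc i" using less_iff_Suc_add by auto
  obtain v where v_ratio: "v \<in> V"
    "(double_ratio ^^ k) (2 * c) = 4 ^ Suc i * (double_ratio ^^ j) (2 * c) * v"
    using funpow_double_ratio_add[OF assms, of j "Suc i"] unfolding k_eq by blast
  have "2 * (2 * 4 ^ i * v) \<noteq> 1"
    by (intro two_mult_neq_1 mem_intros v_ratio)
  moreover have "(double_ratio ^^ j) (2 * c) \<noteq> 0"
    by (rule funpow_double_ratio_even[OF assms, of j]) simp
  ultimately show "(double_ratio ^^ j) (2 * c) \<noteq> (double_ratio ^^ k) (2 * c)"
    using v_ratio(2) by auto
qed

lemma two_div_of_nat_mem:
  assumes "\<not> 4 dvd n"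
  shows "2 / of_nat n \<in> V"
proof -
  have inverse_odd_mem: "inverse (of_nat m) \<in> V" if "odd m" for m
  proof -
    from that obtain j where "m = 2 * j + 1" by (elim oddE)
    then show ?thesis
      using inverse_one_plus_even_mem[OF of_nat_mem[of j]] by (simp add: add.commute)
  qed
  show ?thesis
  proof (cases "even n")
    case True
    then obtain m where n_eq: "n = 2 * m" by (elim evenE)
    then have "odd m" using assms by auto
    moreover have "2 / of_nat n = (inverse (of_nat m) :: 'a)" by (simp add: n_eq inverse_eq_divide)
    ultimately show ?thesis using inverse_odd_mem by metis
  next
    case False
    then show ?thesis using inverse_odd_mem mult_mem numeral_mem by (simp add: divide_inverse)
  qed
qed

lemma parameter_ratio_even:
  assumes t_mem: "t \<in> V" and unit: "1 + t\<^sup>2 \<noteq> 0" "inverse (1 + t\<^sup>2) \<in> V"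
  shows "\<exists>c\<in>V. parameter_ratio t = 2 * c"
proof -
  define e where "e = 2 * (t * inverse (1 + t\<^sup>2))\<^sup>2"
  have e_mem: "e \<in> V" unfolding e_def by (intro mem_intros t_mem unit)
  have "t ^ 4 + 6 * t\<^sup>2 + 1 = (1 + t\<^sup>2)\<^sup>2 * (1 + 2 * e)"
    using unit(1) by (simp add: e_def divide_inverse[symmetric] power_divide distrib_left)
      (simp add: power2_eq_square power4_eq_xxxx algebra_simps)
  then have inverse_eq: "inverse (t ^ 4 + 6 * t\<^sup>2 + 1) = (inverse (1 + t\<^sup>2))\<^sup>2 * inverse (1 + 2 * e)"
    by (simp add: power_inverse)
  have "inverse (t ^ 4 + 6 * t\<^sup>2 + 1) \<in> V"
    unfolding inverse_eq by (intro mult_mem power_mem unit(2) inverse_one_plus_even_mem e_mem)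
  then have "4 * t * (1 + t\<^sup>2) * (1 - t\<^sup>2)\<^sup>2 * (inverse (t ^ 4 + 6 * t\<^sup>2 + 1))\<^sup>2 \<in> V"
    by (intro mem_intros t_mem)
  moreover have "parameter_ratio t =
      2 * (4 * t * (1 + t\<^sup>2) * (1 - t\<^sup>2)\<^sup>2 * (inverse (t ^ 4 + 6 * t\<^sup>2 + 1))\<^sup>2)"
    by (simp add: parameter_ratio_def divide_inverse power_inverse)
  ultimately show ?thesis by blast
qed

lemma obtain_parameter_ratio_even:
  assumes "\<not> 4 dvd n" and n_eq: "of_nat n = 2 * t ^ 3 + 2 * t"
  obtains c where "c \<in> V" "parameter_ratio t = 2 * c"
proof (cases "t \<in> V")
  case True
  have "n \<noteq> 0" using assms(1) by (cases n) auto
  moreover have "(1 + t\<^sup>2) * (t * 2) = of_nat n"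
    unfolding n_eq by (simp add: power2_eq_square power3_eq_cube algebra_simps)
  ultimately have "(1 + t\<^sup>2) * (t * (2 / of_nat n)) = 1"
    by simp
  then have "1 + t\<^sup>2 \<noteq> 0" "inverse (1 + t\<^sup>2) = t * (2 / of_nat n)"
    by (auto intro: inverse_unique)
  then show ?thesis
    using parameter_ratio_even[OF True] two_div_of_nat_mem[OF assms(1)] True mult_mem that by metis
next
  case False
  then have "t \<noteq> 0" "inverse (inverse t) \<notin> V" "inverse t \<in> V"
    using zero_mem mem_or_inverse_mem by auto
  then show ?thesis
    using parameter_ratio_even[of "inverse t"] one_plus_nonunit_nonzero inverse_one_plus_nonunit_mem
      parameter_ratio_inverse that by (metis power2_eq_square)
qed

end

section \<open>The addition law via the lemniscate sine\<close>

text \<open>The points \<open>(s, w)\<close> are \<open>(sl u, sl' u)\<close>, and \<open>euler_add\<close> is Euler's addition theorem for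
  \<open>sl\<close> together with its derivative.\<close>

definition euler_quartic :: "('a::linordered_field \<times> 'a) set" where
  "euler_quartic = {(s, w). w\<^sup>2 = 1 - s ^ 4}"

fun euler_add :: "'a::linordered_field \<times> 'a \<Rightarrow> 'a \<times> 'a \<Rightarrow> 'a \<times> 'a" where
  "euler_add (s1, w1) (s2, w2) =
     ((s1 * w2 + s2 * w1) / (1 + s1\<^sup>2 * s2\<^sup>2),
      (w1 * w2 * (1 - s1\<^sup>2 * s2\<^sup>2) - 2 * s1 * s2 * (s1\<^sup>2 + s2\<^sup>2)) / (1 + s1\<^sup>2 * s2\<^sup>2)\<^sup>2)"

lemma one_plus_squares_nonzero [simp]: "1 + x\<^sup>2 * y\<^sup>2 \<noteq> 0"
  for x y :: "'a::linordered_field"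
  by (simp add: add_pos_nonneg less_imp_neq[symmetric])

lemma euler_add_closed:
  assumes "p \<in> euler_quartic" "q \<in> euler_quartic"
  shows "euler_add p q \<in> euler_quartic"
proof -
  obtain s1 w1 s2 w2 where coords: "p = (s1, w1)" "q = (s2, w2)" by fastforce
  have on_quartic: "w1\<^sup>2 = 1 - s1 ^ 4" "w2\<^sup>2 = 1 - s2 ^ 4"
    using assms by (auto simp: coords euler_quartic_def)
  define S D W where numerators: "S = s1 * w2 + s2 * w1" "D = 1 + s1\<^sup>2 * s2\<^sup>2"
    "W = w1 * w2 * (1 - s1\<^sup>2 * s2\<^sup>2) - 2 * s1 * s2 * (s1\<^sup>2 + s2\<^sup>2)"
  have "D \<noteq> 0" by (simp add: numerators)
  have "W\<^sup>2 = D ^ 4 - S ^ 4"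
    unfolding numerators using on_quartic by Groebner_Basis.algebra
  then have "(W / D\<^sup>2)\<^sup>2 = 1 - (S / D) ^ 4"
    using \<open>D \<noteq> 0\<close> by (simp add: power_divide diff_divide_distrib)
  then show ?thesis by (simp add: coords euler_quartic_def numerators)
qed

lemma euler_add_commute: "euler_add p q = euler_add q p"
  by (cases p; cases q) (simp add: ac_simps)

lemma euler_add_zero [simp]: "euler_add p (0, 1) = p"
  by (cases p) simp

lemma euler_add_fractions:
  fixes S D W s w :: "'a::linordered_field"
  assumes "D \<noteq> 0"
  defines "M \<equiv> D\<^sup>2 + s\<^sup>2 * S\<^sup>2"
  shows "euler_add (S / D, W / D\<^sup>2) (s, w) =
    ((S * D * w + s * W) / M,
     (W * w * (D\<^sup>2 - S\<^sup>2 * s\<^sup>2) - 2 * S * D * s * (S\<^sup>2 + D\<^sup>2 * s\<^sup>2)) / M\<^sup>2)"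
proof -
  have "1 + (S / D)\<^sup>2 * s\<^sup>2 = M / D\<^sup>2"
    using assms(1) by (simp add: M_def power_divide field_simps)
  moreover have "S / D * w + s * (W / D\<^sup>2) = (S * D * w + s * W) / D\<^sup>2"
    using assms(1) by (simp add: power2_eq_square field_simps)
  moreover have "W / D\<^sup>2 * w * (1 - (S / D)\<^sup>2 * s\<^sup>2) - 2 * (S / D) * s * ((S / D)\<^sup>2 + s\<^sup>2) =
      (W * w * (D\<^sup>2 - S\<^sup>2 * s\<^sup>2) - 2 * S * D * s * (S\<^sup>2 + D\<^sup>2 * s\<^sup>2)) / (D\<^sup>2)\<^sup>2"
    using assms(1) by (simp add: power2_eq_square field_simps)
  ultimately show ?thesis
    using assms(1) by (simp add: power_divide)
qed

lemma euler_add_assoc: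
  assumes "p \<in> euler_quartic" "q \<in> euler_quartic" "u \<in> euler_quartic"
  shows "euler_add (euler_add p q) u = euler_add p (euler_add q u)"
proof -
  obtain s1 w1 s2 w2 s3 w3 where coords: "p = (s1, w1)" "q = (s2, w2)" "u = (s3, w3)" by fastforce
  have on_quartic: "w1\<^sup>2 = 1 - s1 ^ 4" "w2\<^sup>2 = 1 - s2 ^ 4" "w3\<^sup>2 = 1 - s3 ^ 4"
    using assms by (auto simp: coords euler_quartic_def)
  define S D W where numerators_pq: "S = s1 * w2 + s2 * w1" "D = 1 + s1\<^sup>2 * s2\<^sup>2"
    "W = w1 * w2 * (1 - s1\<^sup>2 * s2\<^sup>2) - 2 * s1 * s2 * (s1\<^sup>2 + s2\<^sup>2)"
  define S' D' W' where numerators_qu: "S' = s2 * w3 + s3 * w2" "D' = 1 + s2\<^sup>2 * s3\<^sup>2"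
    "W' = w2 * w3 * (1 - s2\<^sup>2 * s3\<^sup>2) - 2 * s2 * s3 * (s2\<^sup>2 + s3\<^sup>2)"
  define M M' where denoms: "M = D\<^sup>2 + s3\<^sup>2 * S\<^sup>2" "M' = D'\<^sup>2 + s1\<^sup>2 * S'\<^sup>2"
  have D_nonzero: "D \<noteq> 0" "D' \<noteq> 0" by (simp_all add: numerators_pq numerators_qu)
  then have denoms_nonzero: "M \<noteq> 0" "M' \<noteq> 0"
    unfolding denoms by (simp_all add: add_pos_nonneg less_imp_neq[symmetric])
  have left: "euler_add (euler_add p q) u = ((S * D * w3 + s3 * W) / M,
      (W * w3 * (D\<^sup>2 - S\<^sup>2 * s3\<^sup>2) - 2 * S * D * s3 * (S\<^sup>2 + D\<^sup>2 * s3\<^sup>2)) / M\<^sup>2)"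
    unfolding denoms using euler_add_fractions[OF D_nonzero(1), of S W s3 w3]
    by (simp add: coords flip: numerators_pq)
  have right: "euler_add p (euler_add q u) = ((S' * D' * w1 + s1 * W') / M',
      (W' * w1 * (D'\<^sup>2 - S'\<^sup>2 * s1\<^sup>2) - 2 * S' * D' * s1 * (S'\<^sup>2 + D'\<^sup>2 * s1\<^sup>2)) / M'\<^sup>2)"
    unfolding denoms euler_add_commute[of p]
    using euler_add_fractions[OF D_nonzero(2), of S' W' s1 w1]
    by (simp add: coords flip: numerators_qu)
  have "(S * D * w3 + s3 * W) * M' = (S' * D' * w1 + s1 * W') * M"
    unfolding denoms numerators_pq numerators_qu using on_quartic by Groebner_Basis.algebra
  moreover have "(W * w3 * (D\<^sup>2 - S\<^sup>2 * s3\<^sup>2) - 2 * S * D * s3 * (S\<^sup>2 + D\<^sup>2 * s3\<^sup>2)) * M'\<^sup>2 =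
      (W' * w1 * (D'\<^sup>2 - S'\<^sup>2 * s1\<^sup>2) - 2 * S' * D' * s1 * (S'\<^sup>2 + D'\<^sup>2 * s1\<^sup>2)) * M\<^sup>2"
    unfolding denoms numerators_pq numerators_qu using on_quartic by Groebner_Basis.algebra
  ultimately show ?thesis
    unfolding left right using denoms_nonzero by (simp add: frac_eq_eq)
qed

fun euler_to_ec :: "'a::linordered_field \<Rightarrow> 'a \<times> 'a \<Rightarrow> 'a ec_point" where
  "euler_to_ec r (s, w) = (if s = 0 then None else Some (r\<^sup>2 / s\<^sup>2, r ^ 3 * w / s ^ 3))"

lemma ec_add_eq_slope:
  fixes a :: "'a::field_char_0"
  assumes "\<not> (x1 = x2 \<and> y1 = - y2)" and "x1 \<noteq> x2 \<Longrightarrow> m * (x2 - x1) = y2 - y1"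
    and "x1 = x2 \<Longrightarrow> y1 \<noteq> 0 \<and> m * (2 * y1) = 3 * x1\<^sup>2 + a"
    and "x3 = m\<^sup>2 - x1 - x2" "y3 = m * (x1 - x3) - y1"
  shows "ec_add a (Some (x1, y1)) (Some (x2, y2)) = Some (x3, y3)"
proof -
  have "(if x1 = x2 then (3 * x1\<^sup>2 + a) / (2 * y1) else (y2 - y1) / (x2 - x1)) = m"
    using assms(2,3) by (cases "x1 = x2") (simp_all add: divide_eq_eq mult.commute)
  with assms(1) show ?thesis by (simp only: ec_add.simps if_False Let_def assms(4,5))
qed

lemma euler_to_ec_add_zero:
  assumes "(0, w) \<in> euler_quartic"
  shows "euler_to_ec r (euler_add p (0, w)) = euler_to_ec r p"
proof -
  have "w = 1 \<or> w = -1" using assms by (simp add: euler_quartic_def power2_eq_1_iff)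
  then show ?thesis by (cases p) auto
qed

lemma euler_to_ec_opposite_iff:
  fixes r s1 w1 s2 w2 :: "'a::linordered_field"
  assumes on_quartic: "w1\<^sup>2 = 1 - s1 ^ 4" "w2\<^sup>2 = 1 - s2 ^ 4" and nonzero: "r \<noteq> 0" "s1 \<noteq> 0" "s2 \<noteq> 0"
  shows "r\<^sup>2 / s1\<^sup>2 = r\<^sup>2 / s2\<^sup>2 \<and> r ^ 3 * w1 / s1 ^ 3 = - (r ^ 3 * w2 / s2 ^ 3) \<longleftrightarrow>
    s1 * w2 + s2 * w1 = 0"
proof -
  have abscissa_iff: "r\<^sup>2 / s1\<^sup>2 = r\<^sup>2 / s2\<^sup>2 \<longleftrightarrow> s1\<^sup>2 = s2\<^sup>2"
    using nonzero by (simp add: frac_eq_eq)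
  have "r ^ 3 * w1 / s1 ^ 3 + r ^ 3 * w2 / s2 ^ 3 =
      r ^ 3 * (w1 * s2 ^ 3 + w2 * s1 ^ 3) / (s1 ^ 3 * s2 ^ 3)"
    using nonzero by (simp add: field_simps)
  then have ordinate_iff: "r ^ 3 * w1 / s1 ^ 3 = - (r ^ 3 * w2 / s2 ^ 3) \<longleftrightarrow>
      w1 * s2 ^ 3 + w2 * s1 ^ 3 = 0"
    using nonzero by (simp add: eq_neg_iff_add_eq_0)
  have "(s1 * w2 + s2 * w1) * (s1 * w2 - s2 * w1) = (s1\<^sup>2 - s2\<^sup>2) * (1 + s1\<^sup>2 * s2\<^sup>2)"
    using on_quartic by Groebner_Basis.algebra
  then have "s1\<^sup>2 = s2\<^sup>2" if "s1 * w2 + s2 * w1 = 0"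
    using that by simp
  moreover have "w1 * s2 ^ 3 + w2 * s1 ^ 3 = s1\<^sup>2 * (s1 * w2 + s2 * w1)" if "s1\<^sup>2 = s2\<^sup>2"
    using that by Groebner_Basis.algebra
  ultimately show ?thesis
    unfolding abscissa_iff ordinate_iff using nonzero by auto
qed

text \<open>The slope of the line through the images of \<open>(s1, w1)\<close> and \<open>(s2, w2)\<close>, in a form that also
  covers tangents.\<close>

definition euler_slope :: "'a::linordered_field \<Rightarrow> 'a \<Rightarrow> 'a \<Rightarrow> 'a \<Rightarrow> 'a \<Rightarrow> 'a" where
  "euler_slope r s1 w1 s2 w2 =
     r * (s1\<^sup>2 + s2\<^sup>2 + s1 * s2 * w1 * w2) / (s1 * s2 * (s1 * w2 + s2 * w1))"

context
  fixes r s1 w1 s2 w2 :: "'a::linordered_field"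
  assumes on_quartic: "w1\<^sup>2 = 1 - s1 ^ 4" "w2\<^sup>2 = 1 - s2 ^ 4"
    and nonzero: "r \<noteq> 0" "s1 \<noteq> 0" "s2 \<noteq> 0" "s1 * w2 + s2 * w1 \<noteq> 0"
begin

lemma euler_slope_chord:
  "euler_slope r s1 w1 s2 w2 * (r\<^sup>2 / s2\<^sup>2 - r\<^sup>2 / s1\<^sup>2) = r ^ 3 * w2 / s2 ^ 3 - r ^ 3 * w1 / s1 ^ 3"
proof -
  define S Q where "S = s1 * w2 + s2 * w1" and "Q = s1\<^sup>2 + s2\<^sup>2 + s1 * s2 * w1 * w2"
  have S_nonzero: "S \<noteq> 0" using nonzero by (simp add: S_def)
  have "Q * (s1\<^sup>2 - s2\<^sup>2) = (w2 * s1 ^ 3 - w1 * s2 ^ 3) * S"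
    unfolding Q_def S_def using on_quartic by Groebner_Basis.algebra
  moreover have "r * Q / (s1 * s2 * S) * (r\<^sup>2 / s2\<^sup>2 - r\<^sup>2 / s1\<^sup>2) =
      r ^ 3 * (Q * (s1\<^sup>2 - s2\<^sup>2)) / (s1 ^ 3 * s2 ^ 3 * S)"
    using nonzero S_nonzero by (simp add: field_simps power2_eq_square power3_eq_cube)
  ultimately have "r * Q / (s1 * s2 * S) * (r\<^sup>2 / s2\<^sup>2 - r\<^sup>2 / s1\<^sup>2) =
      r ^ 3 * (w2 * s1 ^ 3 - w1 * s2 ^ 3) / (s1 ^ 3 * s2 ^ 3)"
    using S_nonzero by simp
  also have "\<dots> = r ^ 3 * w2 / s2 ^ 3 - r ^ 3 * w1 / s1 ^ 3"
    using nonzero by (simp add: field_simps)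
  finally show ?thesis by (simp add: euler_slope_def S_def Q_def)
qed

lemma euler_slope_tangent:
  assumes squares_eq: "s1\<^sup>2 = s2\<^sup>2"
  shows "w1 \<noteq> 0"
    and "euler_slope r s1 w1 s2 w2 * (2 * (r ^ 3 * w1 / s1 ^ 3)) = 3 * (r\<^sup>2 / s1\<^sup>2)\<^sup>2 - (r\<^sup>2)\<^sup>2"
proof -
  define S Q where "S = s1 * w2 + s2 * w1" and "Q = s1\<^sup>2 + s2\<^sup>2 + s1 * s2 * w1 * w2"
  have S_nonzero: "S \<noteq> 0" using nonzero by (simp add: S_def)
  have "w2\<^sup>2 = w1\<^sup>2" using on_quartic squares_eq by Groebner_Basis.algebra
  then show "w1 \<noteq> 0" using nonzero(4) by auto
  have "(s1 * w2 - s2 * w1) * S = 0"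
    unfolding S_def using squares_eq on_quartic by Groebner_Basis.algebra
  then have "s1 * w2 = s2 * w1" using S_nonzero by simp
  then have "2 * w1 * Q = (3 - s1 ^ 4) * s2 * S"
    unfolding Q_def S_def using squares_eq on_quartic by Groebner_Basis.algebra
  moreover have "r * Q / (s1 * s2 * S) * (2 * (r ^ 3 * w1 / s1 ^ 3)) =
      r ^ 4 * (2 * w1 * Q) / (s1 ^ 4 * s2 * S)"
    by (simp add: power3_eq_cube power4_eq_xxxx mult_ac)
  ultimately have "r * Q / (s1 * s2 * S) * (2 * (r ^ 3 * w1 / s1 ^ 3)) =
      r ^ 4 * (3 - s1 ^ 4) / s1 ^ 4"
    using nonzero S_nonzero by simp
  also have "\<dots> = 3 * (r\<^sup>2 / s1\<^sup>2)\<^sup>2 - (r\<^sup>2)\<^sup>2"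
    using nonzero by (simp add: field_simps)
  finally show "euler_slope r s1 w1 s2 w2 * (2 * (r ^ 3 * w1 / s1 ^ 3)) = 3 * (r\<^sup>2 / s1\<^sup>2)\<^sup>2 - (r\<^sup>2)\<^sup>2"
    by (simp add: euler_slope_def S_def Q_def)
qed

lemma euler_slope_third_point:
  fixes x3 :: 'a
  assumes sum_eq: "euler_to_ec r (euler_add (s1, w1) (s2, w2)) = Some (x3, y3)"
  shows "x3 = (euler_slope r s1 w1 s2 w2)\<^sup>2 - r\<^sup>2 / s1\<^sup>2 - r\<^sup>2 / s2\<^sup>2"
    and "y3 = euler_slope r s1 w1 s2 w2 * (r\<^sup>2 / s1\<^sup>2 - x3) - r ^ 3 * w1 / s1 ^ 3"
proof -
  define S D W where numerators: "S = s1 * w2 + s2 * w1" "D = 1 + s1\<^sup>2 * s2\<^sup>2"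
    "W = w1 * w2 * (1 - s1\<^sup>2 * s2\<^sup>2) - 2 * s1 * s2 * (s1\<^sup>2 + s2\<^sup>2)"
  define Q where "Q = s1\<^sup>2 + s2\<^sup>2 + s1 * s2 * w1 * w2"
  have S_nonzero: "S \<noteq> 0" and D_nonzero: "D \<noteq> 0" using nonzero by (simp_all add: numerators)
  define m where "m = r * Q / (s1 * s2 * S)"
  have slope_eq: "euler_slope r s1 w1 s2 w2 = m"
    by (simp add: euler_slope_def m_def Q_def numerators)
  have x3_eq: "x3 = r\<^sup>2 * D\<^sup>2 / S\<^sup>2" and "y3 = r ^ 3 * (W / D\<^sup>2) / (S / D) ^ 3"
    using sum_eq S_nonzero D_nonzero by (auto simp add: power_divide simp flip: numerators)
  then have y3_eq: "y3 = r ^ 3 * W * D / S ^ 3"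
    using S_nonzero D_nonzero by (simp add: field_simps power2_eq_square power3_eq_cube)
  have "Q\<^sup>2 = s1\<^sup>2 * s2\<^sup>2 * D\<^sup>2 + (s1\<^sup>2 + s2\<^sup>2) * S\<^sup>2"
    unfolding Q_def numerators using on_quartic by Groebner_Basis.algebra
  then have "m\<^sup>2 = r\<^sup>2 * (s1\<^sup>2 * s2\<^sup>2 * D\<^sup>2 + (s1\<^sup>2 + s2\<^sup>2) * S\<^sup>2) / (s1\<^sup>2 * s2\<^sup>2 * S\<^sup>2)"
    by (simp add: m_def power_divide power_mult_distrib)
  then show "x3 = (euler_slope r s1 w1 s2 w2)\<^sup>2 - r\<^sup>2 / s1\<^sup>2 - r\<^sup>2 / s2\<^sup>2"
    unfolding slope_eq x3_eq using nonzero S_nonzero by (simp add: field_simps)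
  have "Q * (S\<^sup>2 - s1\<^sup>2 * D\<^sup>2) = w1 * s2 * S ^ 3 + W * D * s1 ^ 3 * s2"
    unfolding Q_def numerators using on_quartic by Groebner_Basis.algebra
  moreover have "m * (r\<^sup>2 / s1\<^sup>2 - x3) = r ^ 3 * (Q * (S\<^sup>2 - s1\<^sup>2 * D\<^sup>2)) / (s1 ^ 3 * s2 * S ^ 3)"
    using nonzero S_nonzero by (simp add: m_def x3_eq field_simps power2_eq_square power3_eq_cube)
  ultimately have "m * (r\<^sup>2 / s1\<^sup>2 - x3) =
      r ^ 3 * (w1 * s2 * S ^ 3 + W * D * s1 ^ 3 * s2) / (s1 ^ 3 * s2 * S ^ 3)"
    by simp
  also have "\<dots> = r ^ 3 * w1 / s1 ^ 3 + y3"
    using nonzero S_nonzero by (simp add: y3_eq field_simps)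
  finally show "y3 = euler_slope r s1 w1 s2 w2 * (r\<^sup>2 / s1\<^sup>2 - x3) - r ^ 3 * w1 / s1 ^ 3"
    by (simp add: slope_eq)
qed

lemma ec_add_euler_to_ec_nonzero:
  "ec_add (- (r\<^sup>2)\<^sup>2) (euler_to_ec r (s1, w1)) (euler_to_ec r (s2, w2)) =
    euler_to_ec r (euler_add (s1, w1) (s2, w2))"
proof -
  obtain x3 y3 where sum_eq: "euler_to_ec r (euler_add (s1, w1) (s2, w2)) = Some (x3, y3)"
    using nonzero(4) by simp
  have "r\<^sup>2 / s1\<^sup>2 = r\<^sup>2 / s2\<^sup>2 \<longleftrightarrow> s1\<^sup>2 = s2\<^sup>2"
    using nonzero by (simp add: frac_eq_eq)
  then show ?thesis
    unfolding sum_eq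
    using nonzero(2,3) euler_to_ec_opposite_iff[OF on_quartic nonzero(1-3)] nonzero(4)
      euler_slope_chord euler_slope_tangent euler_slope_third_point[OF sum_eq]
    by (simp only: euler_to_ec.simps if_False, intro ec_add_eq_slope)
      (auto simp only: nonzero divide_eq_0_iff mult_eq_0_iff power_eq_0_iff)
qed

end

theorem ec_add_euler_to_ec:
  assumes p: "p \<in> euler_quartic" and q: "q \<in> euler_quartic" and r_nonzero: "r \<noteq> 0"
  shows "ec_add (- (r\<^sup>2)\<^sup>2) (euler_to_ec r p) (euler_to_ec r q) = euler_to_ec r (euler_add p q)"
proof -
  obtain s1 w1 s2 w2 where coords: "p = (s1, w1)" "q = (s2, w2)" by fastforce
  have on_quartic: "w1\<^sup>2 = 1 - s1 ^ 4" "w2\<^sup>2 = 1 - s2 ^ 4"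
    using p q by (auto simp: coords euler_quartic_def)
  consider (left_zero) "s1 = 0" | (right_zero) "s2 = 0"
    | (opposite) "s1 \<noteq> 0" "s2 \<noteq> 0" "s1 * w2 + s2 * w1 = 0"
    | (sum_nonzero) "s1 \<noteq> 0" "s2 \<noteq> 0" "s1 * w2 + s2 * w1 \<noteq> 0" by blast
  then show ?thesis
  proof cases
    case left_zero
    then show ?thesis
      using euler_to_ec_add_zero[of w1 r q] p euler_add_commute[of p q]
      by (simp add: coords(1) del: euler_add.simps)
  next
    case right_zero
    then show ?thesis
      using euler_to_ec_add_zero[of w2 r p] q
      by (cases "euler_to_ec r p") (simp_all add: coords(2) del: euler_add.simps)
  next
    case opposite
    then show ?thesis
      using euler_to_ec_opposite_iff[OF on_quartic r_nonzero opposite(1,2)] by (simp add: coords)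
  next
    case sum_nonzero
    show ?thesis
      unfolding coords by (rule ec_add_euler_to_ec_nonzero[OF on_quartic r_nonzero sum_nonzero])
  qed
qed

definition euler_monoid :: "('a::linordered_field \<times> 'a) monoid" where
  "euler_monoid = \<lparr>carrier = euler_quartic, monoid.mult = euler_add, one = (0, 1)\<rparr>"

lemma monoid_euler_monoid: "Group.monoid euler_monoid"
  by (rule monoidI)
    (simp_all add: euler_monoid_def euler_add_closed euler_add_assoc euler_add_commute[of "(0, 1)"]
        del: euler_add.simps,
      simp add: euler_quartic_def)

lemma ec_group_simps [simp]:
  "x \<otimes>\<^bsub>ec_group K a b\<^esub> y = ec_add a x y" "\<one>\<^bsub>ec_group K a b\<^esub> = None"
  by (simp_all add: ec_group_def)

lemma euler_to_ec_power:
  assumes "p \<in> euler_quartic" "r \<noteq> 0"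
  shows "euler_to_ec r p [^]\<^bsub>ec_group K (- (r\<^sup>2)\<^sup>2) b\<^esub> (k::nat) = euler_to_ec r (p [^]\<^bsub>euler_monoid\<^esub> k)"
proof (induction k)
  case 0
  show ?case by (simp add: nat_pow_def euler_monoid_def)
next
  case (Suc k)
  have "p [^]\<^bsub>euler_monoid\<^esub> k \<in> euler_quartic"
    using monoid.nat_pow_closed[OF monoid_euler_monoid, of p k] assms(1)
    by (simp add: euler_monoid_def)
  then show ?case
    using Suc.IH ec_add_euler_to_ec[OF _ assms, of "p [^]\<^bsub>euler_monoid\<^esub> k"]
    by (simp add: nat_pow_def) (simp add: euler_monoid_def)
qed

lemma obtain_euler_point:
  fixes x y N :: real
  assumes "y\<^sup>2 = x ^ 3 - N\<^sup>2 * x" "x > 0" "N > 0"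
  obtains p where "p \<in> euler_quartic" "euler_to_ec (sqrt N) p = Some (x, y)"
proof
  define r s where "r = sqrt N" and "s = sqrt (N / x)"
  have sqrts: "r > 0" "s > 0" "r\<^sup>2 = N" "s\<^sup>2 = N / x" using assms by (simp_all add: r_def s_def)
  define w where "w = y * s ^ 3 / r ^ 3"
  have "w\<^sup>2 = y\<^sup>2 * (s\<^sup>2) ^ 3 / (r\<^sup>2) ^ 3"
    by (simp add: w_def power_divide power_mult_distrib)
  also have "\<dots> = 1 - (s\<^sup>2)\<^sup>2"
    unfolding sqrts assms(1) using assms(2,3)
    by (simp add: power_divide field_simps power2_eq_square power3_eq_cube)
  finally have "w\<^sup>2 = 1 - s ^ 4" by simp
  then show "(s, w) \<in> euler_quartic" by (simp add: euler_quartic_def)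
  show "euler_to_ec (sqrt N) (s, w) = Some (x, y)"
    using sqrts assms by (simp add: w_def flip: r_def)
qed

lemma ec_group_power_add:
  fixes x y N :: real
  assumes "y\<^sup>2 = x ^ 3 - N\<^sup>2 * x" "x > 0" "N > 0"
  shows "Some (x, y) [^]\<^bsub>ec_group K (- N\<^sup>2) b\<^esub> (j + k :: nat) =
    ec_add (- N\<^sup>2) (Some (x, y) [^]\<^bsub>ec_group K (- N\<^sup>2) b\<^esub> j) (Some (x, y) [^]\<^bsub>ec_group K (- N\<^sup>2) b\<^esub> k)"
proof -
  obtain p where p_image: "p \<in> euler_quartic" "euler_to_ec (sqrt N) p = Some (x, y)"
    using obtain_euler_point[OF assms] .
  have sqrt_N: "sqrt N \<noteq> 0" "(sqrt N)\<^sup>2 = N" using assms(3) by auto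
  interpret euler: monoid euler_monoid by (rule monoid_euler_monoid)
  have closed: "p [^]\<^bsub>euler_monoid\<^esub> i \<in> euler_quartic" for i :: nat
    using euler.nat_pow_closed[of p i] p_image(1) by (simp add: euler_monoid_def)
  have "p [^]\<^bsub>euler_monoid\<^esub> (j + k) = euler_add (p [^]\<^bsub>euler_monoid\<^esub> j) (p [^]\<^bsub>euler_monoid\<^esub> k)"
    using euler.nat_pow_mult[of p j k] p_image(1) by (simp add: euler_monoid_def)
  then show ?thesis
    using euler_to_ec_power[OF p_image(1) sqrt_N(1), of K b]
      ec_add_euler_to_ec[OF closed closed sqrt_N(1)]
    by (simp add: p_image(2) sqrt_N(2))
qed

section \<open>Points of infinite order\<close>

lemma infinite_order_inI:
  fixes G :: "('a, 'b) monoid_scheme"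
  assumes mem: "P \<in> carrier G"
    and zero: "P [^]\<^bsub>G\<^esub> (0::nat) = \<one>\<^bsub>G\<^esub>"
    and add: "\<And>j k::nat. P [^]\<^bsub>G\<^esub> (j + k) = P [^]\<^bsub>G\<^esub> j \<otimes>\<^bsub>G\<^esub> P [^]\<^bsub>G\<^esub> k"
    and infinite: "infinite (range (\<lambda>k::nat. P [^]\<^bsub>G\<^esub> k))"
  shows "infinite_order_in G P"
  unfolding infinite_order_in_def
proof (intro conjI mem allI impI notI)
  fix m :: nat assume "m > 0" and vanishes: "P [^]\<^bsub>G\<^esub> m = \<one>\<^bsub>G\<^esub>"
  have "P [^]\<^bsub>G\<^esub> (m + i) = P [^]\<^bsub>G\<^esub> i" for i
    using add[of m i] add[of 0 i] zero vanishes by simp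
  then have "P [^]\<^bsub>G\<^esub> (k * m + i) = P [^]\<^bsub>G\<^esub> i" for k i
    by (induction k) (simp_all add: add.assoc)
  then have power_mod: "P [^]\<^bsub>G\<^esub> i = P [^]\<^bsub>G\<^esub> (i mod m)" for i :: nat
    by (metis div_mult_mod_eq)
  have "P [^]\<^bsub>G\<^esub> i \<in> (\<lambda>k. P [^]\<^bsub>G\<^esub> k) ` {..<m}" for i :: nat
    using \<open>m > 0\<close> by (intro image_eqI[where x = "i mod m"] power_mod) simp
  then have "range (\<lambda>k::nat. P [^]\<^bsub>G\<^esub> k) \<subseteq> (\<lambda>k. P [^]\<^bsub>G\<^esub> k) ` {..<m}"
    by blast
  then show False using infinite finite_subset by blast
qed

lemma ec_add_self:
  fixes x y a b :: "'a::field_char_0"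
  assumes curve: "y\<^sup>2 = x ^ 3 + a * x + b" and y_nonzero: "y \<noteq> 0"
  obtains x' y' where "ec_add a (Some (x, y)) (Some (x, y)) = Some (x', y')"
    "x' = (x ^ 4 - 2 * a * x\<^sup>2 - 8 * b * x + a\<^sup>2) / (4 * y\<^sup>2)" "y'\<^sup>2 = x' ^ 3 + a * x' + b"
    "\<And>K. subfield K ring_of_type_algebra \<Longrightarrow> a \<in> K \<Longrightarrow> x \<in> K \<Longrightarrow> y \<in> K \<Longrightarrow> x' \<in> K \<and> y' \<in> K"
proof
  define m where "m = (3 * x\<^sup>2 + a) / (2 * y)"
  define x' where "x' = m\<^sup>2 - x - x"
  define y' where "y' = m * (x - x') - y"
  have slope_eq: "m * (2 * y) = 3 * x\<^sup>2 + a" using y_nonzero by (simp add: m_def)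
  show "ec_add a (Some (x, y)) (Some (x, y)) = Some (x', y')"
    using y_nonzero by (simp add: Let_def m_def x'_def y'_def)
  have "x' * (4 * y\<^sup>2) = x ^ 4 - 2 * a * x\<^sup>2 - 8 * b * x + a\<^sup>2"
    unfolding x'_def using slope_eq curve by Groebner_Basis.algebra
  then show "x' = (x ^ 4 - 2 * a * x\<^sup>2 - 8 * b * x + a\<^sup>2) / (4 * y\<^sup>2)"
    using y_nonzero by (simp add: eq_divide_eq)
  show "y'\<^sup>2 = x' ^ 3 + a * x' + b"
    unfolding y'_def x'_def using slope_eq curve by Groebner_Basis.algebra
  fix K assume "subfield K (ring_of_type_algebra :: 'a ring)" and mem: "a \<in> K" "x \<in> K" "y \<in> K"
  then interpret subfield_of_field K by (intro subfield_of_field.intro)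
  have "m \<in> K" unfolding m_def by (intro field_mem_intros mem)
  moreover from this have "x' \<in> K" unfolding x'_def by (intro field_mem_intros mem)
  ultimately show "x' \<in> K \<and> y' \<in> K" unfolding y'_def by (intro conjI field_mem_intros mem)
qed

lemma double_ratio_on_curve:
  fixes x y N :: "'a::field"
  assumes "x \<noteq> 0" and curve: "y\<^sup>2 = x ^ 3 - N\<^sup>2 * x"
  shows "double_ratio (N / x) = 4 * N * y\<^sup>2 / (x\<^sup>2 + N\<^sup>2)\<^sup>2"
proof -
  have "1 - (N / x)\<^sup>2 = (x\<^sup>2 - N\<^sup>2) / x\<^sup>2" "1 + (N / x)\<^sup>2 = (x\<^sup>2 + N\<^sup>2) / x\<^sup>2"
    using \<open>x \<noteq> 0\<close> by (simp_all add: field_simps)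
  moreover have "y\<^sup>2 = x * (x\<^sup>2 - N\<^sup>2)" unfolding curve by Groebner_Basis.algebra
  ultimately show ?thesis
    using \<open>x \<noteq> 0\<close> by (simp add: double_ratio_def power_divide)
      (simp add: power2_eq_square power4_eq_xxxx)
qed

locale injective_doubling = subfield_of_field K for K :: "real set" +
  fixes N x y :: real
  assumes mem: "N \<in> K" "x \<in> K" "y \<in> K"
    and curve: "y\<^sup>2 = x ^ 3 - N\<^sup>2 * x" and pos: "x > 0" "N > 0"
    and inj_ratio: "inj (\<lambda>k. (double_ratio ^^ k) (N / x))"
begin

abbreviation "E \<equiv> ec_group K (- N\<^sup>2) 0"

lemma mem_carrier_E: "Some (u, v) \<in> carrier E \<longleftrightarrow> u \<in> K \<and> v \<in> K \<and> v\<^sup>2 = u ^ 3 - N\<^sup>2 * u"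
  by (auto simp: ec_group_def)

lemma ratio_nonzero: "(double_ratio ^^ k) (N / x) \<noteq> 0"
proof
  assume "(double_ratio ^^ k) (N / x) = 0"
  then have "(double_ratio ^^ Suc k) (N / x) = (double_ratio ^^ k) (N / x)"
    by (simp add: double_ratio_def)
  then have "Suc k = k" by (rule injD[OF inj_ratio])
  then show False by simp
qed

lemma double_step:
  assumes carrier: "Some (u, v) \<in> carrier E" and ratio: "N / u \<noteq> 0" "double_ratio (N / u) \<noteq> 0"
  obtains u' v' where "ec_add (- N\<^sup>2) (Some (u, v)) (Some (u, v)) = Some (u', v')"
    "Some (u', v') \<in> carrier E" "N / u' = double_ratio (N / u)"
proof -
  have on_curve: "v\<^sup>2 = u ^ 3 + - N\<^sup>2 * u + 0" and uv_mem: "u \<in> K" "v \<in> K"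
    using carrier by (auto simp: mem_carrier_E)
  have "u \<noteq> 0" using ratio(1) by auto
  moreover have "v\<^sup>2 = u ^ 3 - N\<^sup>2 * u" using on_curve by simp
  ultimately have ratio_eq: "double_ratio (N / u) = 4 * N * v\<^sup>2 / (u\<^sup>2 + N\<^sup>2)\<^sup>2"
    by (rule double_ratio_on_curve)
  then have "v \<noteq> 0" using ratio(2) by auto
  obtain u' v' where double: "ec_add (- N\<^sup>2) (Some (u, v)) (Some (u, v)) = Some (u', v')"
    "u' = (u ^ 4 - 2 * (- N\<^sup>2) * u\<^sup>2 - 8 * 0 * u + (- N\<^sup>2)\<^sup>2) / (4 * v\<^sup>2)"
    "v'\<^sup>2 = u' ^ 3 + - N\<^sup>2 * u' + 0" "u' \<in> K \<and> v' \<in> K"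
    using ec_add_self[OF on_curve \<open>v \<noteq> 0\<close>] subfield uminus_mem power_mem mem(1) uv_mem by metis
  have "u ^ 4 - 2 * (- N\<^sup>2) * u\<^sup>2 - 8 * 0 * u + (- N\<^sup>2)\<^sup>2 = (u\<^sup>2 + N\<^sup>2)\<^sup>2"
    by Groebner_Basis.algebra
  then have "N / u' = double_ratio (N / u)"
    unfolding ratio_eq double(2) by simp
  then show thesis
    using that double by (simp add: mem_carrier_E)
qed

lemma power_two_power:
  "\<exists>u v. Some (x, y) [^]\<^bsub>E\<^esub> (2 ^ k :: nat) = Some (u, v) \<and> Some (u, v) \<in> carrier E \<and>
    N / u = (double_ratio ^^ k) (N / x)"
proof (induction k)
  case 0
  have "Some (x, y) [^]\<^bsub>E\<^esub> (1::nat) = Some (x, y)" by (simp add: nat_pow_def)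
  then show ?case using mem curve by (simp add: mem_carrier_E)
next
  case (Suc k)
  then obtain u v where uv_power: "Some (x, y) [^]\<^bsub>E\<^esub> (2 ^ k :: nat) = Some (u, v)"
    "Some (u, v) \<in> carrier E"
    "N / u = (double_ratio ^^ k) (N / x)" by blast
  moreover have "double_ratio (N / u) = (double_ratio ^^ Suc k) (N / x)" using uv_power(3) by simp
  ultimately obtain u' v' where "ec_add (- N\<^sup>2) (Some (u, v)) (Some (u, v)) = Some (u', v')"
    "Some (u', v') \<in> carrier E" "N / u' = (double_ratio ^^ Suc k) (N / x)"
    using double_step[OF uv_power(2)] ratio_nonzero[of k] ratio_nonzero[of "Suc k"] by metis
  moreover have "Some (x, y) [^]\<^bsub>E\<^esub> (2 ^ Suc k :: nat) = ec_add (- N\<^sup>2) (Some (u, v)) (Some (u, v))"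
    using ec_group_power_add[OF curve pos, of K 0 "2 ^ k" "2 ^ k"] uv_power(1) by (simp add: mult_2)
  ultimately show ?case by auto
qed

lemma inj_power_two_power: "inj (\<lambda>k. Some (x, y) [^]\<^bsub>E\<^esub> (2 ^ k :: nat))"
proof (rule injI)
  fix j k assume "Some (x, y) [^]\<^bsub>E\<^esub> (2 ^ j :: nat) = Some (x, y) [^]\<^bsub>E\<^esub> (2 ^ k :: nat)"
  then have "(double_ratio ^^ j) (N / x) = (double_ratio ^^ k) (N / x)"
    using power_two_power[of j] power_two_power[of k] by auto
  then show "j = k" by (rule injD[OF inj_ratio])
qed

lemma infinite_order: "infinite_order_in E (Some (x, y))"
proof (rule infinite_order_inI)
  show "Some (x, y) \<in> carrier E" using mem curve by (simp add: mem_carrier_E)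
  show "Some (x, y) [^]\<^bsub>E\<^esub> (j + k :: nat) = Some (x, y) [^]\<^bsub>E\<^esub> j \<otimes>\<^bsub>E\<^esub> Some (x, y) [^]\<^bsub>E\<^esub> k" for j k
    using ec_group_power_add[OF curve pos] by simp
  have "infinite (range (\<lambda>k. Some (x, y) [^]\<^bsub>E\<^esub> (2 ^ k :: nat)))"
    using inj_power_two_power by (rule range_inj_infinite)
  then show "infinite (range (\<lambda>k::nat. Some (x, y) [^]\<^bsub>E\<^esub> k))"
    by (rule infinite_super[rotated]) auto
qed (simp add: nat_pow_def)

lemma infinite_carrier: "infinite (carrier E)"
proof -
  have "range (\<lambda>k. Some (x, y) [^]\<^bsub>E\<^esub> (2 ^ k :: nat)) \<subseteq> carrier E"
    by (intro image_subsetI) (metis power_two_power)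
  then show ?thesis
    using range_inj_infinite[OF inj_power_two_power] infinite_super by metis
qed

end

section \<open>Triangles from points\<close>

definition triangle :: "'a::field \<Rightarrow> 'a \<times> 'a \<Rightarrow> 'a \<times> 'a \<times> 'a" where
  "triangle N = (\<lambda>(x, y). ((x\<^sup>2 - N\<^sup>2) / y, 2 * N * x / y, (x\<^sup>2 + N\<^sup>2) / y))"

lemma inj_on_triangle:
  fixes N :: "'a::field_char_0"
  assumes "N \<noteq> 0"
  shows "inj_on (triangle N) {(x, y). x \<noteq> 0 \<and> y \<noteq> 0}"
proof (rule inj_on_inverseI, clarify)
  fix x y :: 'a assume "x \<noteq> 0" "y \<noteq> 0"
  then show "(\<lambda>(a, b, c). ((a + c) / b * N, 2 * N\<^sup>2 * (a + c) / b\<^sup>2)) (triangle N (x, y)) = (x, y)"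
    using assms by (simp add: triangle_def field_simps power2_eq_square)
qed

lemma triangle_mem_congruent_solutions:
  fixes K :: "'a::field_char_0 set"
  assumes subfield: "subfield K ring_of_type_algebra" and mem: "x \<in> K" "y \<in> K" "y \<noteq> 0"
    and curve: "y\<^sup>2 = x ^ 3 - (of_nat n)\<^sup>2 * x"
  shows "triangle (of_nat n) (x, y) \<in> congruent_solutions K n"
proof -
  interpret subfield_of_field K by (rule subfield_of_field.intro[OF subfield])
  define N :: 'a where "N = of_nat n"
  have N_mem: "N \<in> K" by (simp add: N_def of_nat_mem)
  have "((x\<^sup>2 - N\<^sup>2) / y)\<^sup>2 + (2 * N * x / y)\<^sup>2 = ((x\<^sup>2 - N\<^sup>2)\<^sup>2 + (2 * N * x)\<^sup>2) / y\<^sup>2"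
    by (simp add: power_divide add_divide_distrib)
  also have "(x\<^sup>2 - N\<^sup>2)\<^sup>2 + (2 * N * x)\<^sup>2 = (x\<^sup>2 + N\<^sup>2)\<^sup>2" by Groebner_Basis.algebra
  finally have pythagoras: "((x\<^sup>2 - N\<^sup>2) / y)\<^sup>2 + (2 * N * x / y)\<^sup>2 = ((x\<^sup>2 + N\<^sup>2) / y)\<^sup>2"
    by (simp add: power_divide)
  have "1 / 2 * ((x\<^sup>2 - N\<^sup>2) / y) * (2 * N * x / y) = (x\<^sup>2 - N\<^sup>2) * (N * x) / y\<^sup>2"
    by (simp add: power2_eq_square)
  also have "(x\<^sup>2 - N\<^sup>2) * (N * x) = N * y\<^sup>2" unfolding curve N_def by Groebner_Basis.algebra
  finally have area: "1 / 2 * ((x\<^sup>2 - N\<^sup>2) / y) * (2 * N * x / y) = N" using mem(3) by simp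
  have "(x\<^sup>2 - N\<^sup>2) / y \<in> K" "2 * N * x / y \<in> K" "(x\<^sup>2 + N\<^sup>2) / y \<in> K"
    by (intro field_mem_intros mem(1,2) N_mem)+
  with pythagoras area show ?thesis
    unfolding triangle_def congruent_solutions_def N_def
    by (simp only: prod.case mem_Collect_eq simp_thms)
qed

lemma infinite_congruent_solutions:
  fixes K :: "'a::field_char_0 set"
  assumes subfield: "subfield K ring_of_type_algebra" and "n > 0"
    and infinite: "infinite (carrier (congruent_curve n K))"
  shows "infinite (congruent_solutions K n)"
proof -
  define N :: 'a where "N = of_nat n"
  have "N \<noteq> 0" using \<open>n > 0\<close> by (simp add: N_def)
  define C where "C = {(x, y). x \<in> K \<and> y \<in> K \<and> y \<noteq> 0 \<and> y\<^sup>2 = x ^ 3 - N\<^sup>2 * x}"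
  have "y \<noteq> 0 \<or> x \<in> {0, N, - N}" if "y\<^sup>2 = x ^ 3 - N\<^sup>2 * x" for x y
  proof -
    have "y\<^sup>2 = x * (x - N) * (x + N)" unfolding that by Groebner_Basis.algebra
    then show ?thesis by (auto simp: eq_neg_iff_add_eq_0)
  qed
  then have "carrier (congruent_curve n K) \<subseteq> insert None (Some ` (C \<union> {0, N, - N} \<times> {0}))"
    by (auto simp: congruent_curve_def ec_group_def C_def image_iff simp flip: N_def)
  then have "infinite C"
    using infinite
    by (metis finite_Un finite_SigmaI finite.emptyI finite.insertI finite_imageI finite_subset)
  moreover have "inj_on (triangle N) C"
    using inj_on_triangle[OF \<open>N \<noteq> 0\<close>] by (rule inj_on_subset) (auto simp: C_def)
  moreover have "triangle N ` C \<subseteq> congruent_solutions K n"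
    using triangle_mem_congruent_solutions[OF subfield] by (auto simp: C_def N_def)
  ultimately show ?thesis
    by (meson finite_imageD infinite_super)
qed

section \<open>The parametrised cubic\<close>

lemma rational_parameter_imp_4_dvd:
  fixes t :: real
  assumes "t \<in> \<rat>" and n_eq: "real n = 2 * t ^ 3 + 2 * t"
  shows "4 dvd n"
proof -
  have "algebraic_int (2 * t)"
  proof
    show "poly [:- 4 * real n, 4, 0, 1:] (2 * t) = 0"
      unfolding n_eq by (simp add: power3_eq_cube algebra_simps)
  qed (auto simp: coeff_pCons split: nat.split)
  then have "2 * t \<in> \<int>"
    using assms(1) by (intro rational_algebraic_int_is_int) auto
  then obtain m where twice_t: "2 * t = of_int m" by (auto elim: Ints_cases)
  have "4 * real n = (2 * t) ^ 3 + 4 * (2 * t)"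
    unfolding n_eq by (simp add: power_mult_distrib)
  then have "of_int (4 * int n) = real_of_int (m ^ 3 + 4 * m)" by (simp add: twice_t)
  then have int_n_eq: "4 * int n = m ^ 3 + 4 * m" by (simp only: of_int_eq_iff)
  then have "even (m ^ 3 + 4 * m)" by (metis dvd_mult2 even_numeral)
  then obtain j where "m = 2 * j" by auto
  with int_n_eq have half_n_eq: "int n = 2 * (j * (j\<^sup>2 + 1))"
    by (simp add: power2_eq_square power3_eq_cube algebra_simps)
  have "even (j * (j\<^sup>2 + 1))" by simp
  then have "2 * 2 dvd int n" unfolding half_n_eq by (intro mult_dvd_mono) auto
  then show ?thesis by presburger
qed

lemma cubic_root_iff:
  assumes "n > 0"
  shows "cubic_root n l \<longleftrightarrow> (\<exists>t. real n = 2 * t ^ 3 + 2 * t \<and> l = - t\<^sup>2 / 2)"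
proof
  assume "cubic_root n l"
  then have cubic: "8 * l * (1 - 2 * l)\<^sup>2 = - (real n)\<^sup>2"
    unfolding cubic_root_def by Groebner_Basis.algebra
  then have nonzero: "1 - 2 * l \<noteq> 0" using assms by auto
  define t where "t = real n / (2 * (1 - 2 * l))"
  have n_eq: "real n = t * (2 * (1 - 2 * l))" using nonzero by (simp add: t_def)
  have "4 * ((t\<^sup>2 + 2 * l) * (1 - 2 * l)\<^sup>2) = 0"
    using cubic unfolding n_eq by Groebner_Basis.algebra
  then have l_eq: "l = - t\<^sup>2 / 2" using nonzero by simp
  moreover have "real n = 2 * t ^ 3 + 2 * t"
    unfolding n_eq by (simp add: l_eq power2_eq_square power3_eq_cube algebra_simps)
  ultimately show "\<exists>t. real n = 2 * t ^ 3 + 2 * t \<and> l = - t\<^sup>2 / 2" by blast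
next
  assume "\<exists>t. real n = 2 * t ^ 3 + 2 * t \<and> l = - t\<^sup>2 / 2"
  then obtain t where n_eq: "real n = 2 * t ^ 3 + 2 * t" and "t\<^sup>2 = - (2 * l)" by auto
  then show "cubic_root n l"
    unfolding cubic_root_def n_eq by Groebner_Basis.algebra
qed

lemma ex1_parameter: "\<exists>!t::real. real n = 2 * t ^ 3 + 2 * t"
proof (rule ex_ex1I)
  have "\<exists>t\<ge>0. t \<le> real n \<and> 2 * t ^ 3 + 2 * t = real n"
    by (rule IVT') (auto intro!: continuous_intros)
  then show "\<exists>t::real. real n = 2 * t ^ 3 + 2 * t" by metis
next
  have mono: "2 * t ^ 3 + 2 * t < 2 * u ^ 3 + 2 * u" if "t < u" for t u :: real
    using power_mono_odd[of 3 t u] that by simp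
  show "t = u" if "real n = 2 * t ^ 3 + 2 * t" "real n = 2 * u ^ 3 + 2 * u" for t u :: real
    using mono[of t u] mono[of u t] that by linarith
qed

lemma cubic_root_ex1:
  assumes "n > 0"
  shows "\<exists>!l. cubic_root n l"
  using ex1_parameter[of n] unfolding cubic_root_iff[OF assms] by auto

locale parametrized_congruent_curve =
  fixes t :: real and n :: nat
  assumes not_4_dvd: "\<not> 4 dvd n" and n_eq: "real n = 2 * t ^ 3 + 2 * t"
begin

lemma n_pos: "n > 0"
  using not_4_dvd by (cases n) auto

lemma one_minus_square_nonzero: "1 - t\<^sup>2 \<noteq> 0"
proof
  assume "1 - t\<^sup>2 = 0"
  then have "t = 1 \<or> t = -1" by (simp add: power2_eq_1_iff)
  then show False using rational_parameter_imp_4_dvd[OF _ n_eq] not_4_dvd by auto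
qed

lemma rat_adjoin_root_eq: "rat_adjoin (- t\<^sup>2 / 2) = rat_adjoin t"
proof
  note field_mem_intros =
    subfield_of_field.field_mem_intros[OF subfield_of_field.intro[OF subfield_rat_adjoin]]
  show "rat_adjoin (- t\<^sup>2 / 2) \<subseteq> rat_adjoin t"
    by (intro rat_adjoin_subset subfield_rat_adjoin field_mem_intros self_mem_rat_adjoin)
  define l where "l = - t\<^sup>2 / 2"
  have "2 * (1 - 2 * l) * t = real n"
    unfolding n_eq l_def by (simp add: power2_eq_square power3_eq_cube algebra_simps)
  moreover have "1 - 2 * l > 0" by (simp add: l_def add_pos_nonneg)
  ultimately have "t = real n / (2 * (1 - 2 * l))" by (simp add: field_simps)
  also have "\<dots> \<in> rat_adjoin l"
    by (intro field_mem_intros self_mem_rat_adjoin)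
  finally show "rat_adjoin t \<subseteq> rat_adjoin (- t\<^sup>2 / 2)"
    unfolding l_def by (intro rat_adjoin_subset subfield_rat_adjoin)
qed

lemma real_cubic_field_root: "real_cubic_field (rat_adjoin (- t\<^sup>2 / 2))"
  unfolding rat_adjoin_root_eq
proof (rule real_cubic_field_rat_adjoin[of 0 1 "- real n / 2"])
  show "t ^ 3 + 0 * t\<^sup>2 + 1 * t + - real n / 2 = 0" unfolding n_eq by simp
  show "s ^ 3 + 0 * s\<^sup>2 + 1 * s + - real n / 2 \<noteq> 0" if "s \<in> \<rat>" for s
    using rational_parameter_imp_4_dvd[OF that, of n] not_4_dvd by auto
qed simp_all

lemma point_coords_eq:
  "x_coord (real n) (- t\<^sup>2 / 2) = (t ^ 4 + 6 * t\<^sup>2 + 1)\<^sup>2 / (4 * (1 - t\<^sup>2)\<^sup>2)"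
  "y_coord (real n) (- t\<^sup>2 / 2) =
    (t ^ 4 + 6 * t\<^sup>2 + 1) * ((1 - t\<^sup>2) ^ 4 - 16 * t\<^sup>2 * (1 + t\<^sup>2)\<^sup>2) / (8 * (1 - t\<^sup>2) ^ 3)"
proof -
  define l where "l = - t\<^sup>2 / 2"
  have t_squared: "t\<^sup>2 = - (2 * l)" by (simp add: l_def)
  define u where "u = 1 - t\<^sup>2"
  define w where "w = t ^ 4 + 3 * t\<^sup>2 + 4"
  have "w > 0" by (simp add: w_def add_nonneg_pos)
  then have nonzero: "u \<noteq> 0" "w \<noteq> 0" using one_minus_square_nonzero by (simp_all add: u_def)
  have denominator: "real n ^ 2 - 16 = - (4 * u * w)"
    unfolding n_eq u_def w_def by Groebner_Basis.algebra
  have x_numerator: "256 + 992 * real n ^ 2 + 65 * real n ^ 4 + (1024 - 2688 * real n ^ 2 - 28 * real n ^ 4) * l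
      + (1024 + 1920 * real n ^ 2 + 4 * real n ^ 4) * l ^ 2 = 16 * (t ^ 4 + 6 * t\<^sup>2 + 1)\<^sup>2 * w\<^sup>2"
    unfolding n_eq w_def using t_squared by Groebner_Basis.algebra
  show "x_coord (real n) (- t\<^sup>2 / 2) = (t ^ 4 + 6 * t\<^sup>2 + 1)\<^sup>2 / (4 * (1 - t\<^sup>2)\<^sup>2)"
    unfolding x_coord_def l_def[symmetric] x_numerator denominator u_def[symmetric] using nonzero
    by (simp add: power_mult_distrib)
  have y_numerator: "- 16384 + 72704 * real n ^ 2 + 80960 * real n ^ 4 + 2868 * real n ^ 6 - real n ^ 8
      + (196608 - 462848 * real n ^ 2 - 145152 * real n ^ 4 - 1456 * real n ^ 6) * l
      + (196608 + 421888 * real n ^ 2 + 100608 * real n ^ 4 + 208 * real n ^ 6) * l ^ 2 =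
      - (256 * ((t ^ 4 + 6 * t\<^sup>2 + 1) * (u ^ 4 - 16 * t\<^sup>2 * (1 + t\<^sup>2)\<^sup>2)) * w ^ 3)"
    unfolding n_eq w_def u_def using t_squared by Groebner_Basis.algebra
  show "y_coord (real n) (- t\<^sup>2 / 2) =
    (t ^ 4 + 6 * t\<^sup>2 + 1) * ((1 - t\<^sup>2) ^ 4 - 16 * t\<^sup>2 * (1 + t\<^sup>2)\<^sup>2) / (8 * (1 - t\<^sup>2) ^ 3)"
    unfolding y_coord_def l_def[symmetric] y_numerator denominator u_def[symmetric] using nonzero
    by (simp add: power_mult_distrib power3_eq_cube)
qed

abbreviation P_x where "P_x \<equiv> x_coord (real n) (- t\<^sup>2 / 2)"
abbreviation P_y where "P_y \<equiv> y_coord (real n) (- t\<^sup>2 / 2)"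

lemma on_curve: "P_y\<^sup>2 = P_x ^ 3 - (real n)\<^sup>2 * P_x"
proof -
  define u a b where "u = 1 - t\<^sup>2" and "a = t ^ 4 + 6 * t\<^sup>2 + 1" and "b = 16 * t\<^sup>2 * (1 + t\<^sup>2)\<^sup>2"
  have u_nonzero: "u \<noteq> 0" using one_minus_square_nonzero by (simp add: u_def)
  have "a\<^sup>2 = u ^ 4 + b" unfolding a_def b_def u_def by Groebner_Basis.algebra
  then have "(u ^ 4 - b)\<^sup>2 = a ^ 4 - 4 * b * u ^ 4" by Groebner_Basis.algebra
  then have "(a * (u ^ 4 - b) / (8 * u ^ 3))\<^sup>2 = a\<^sup>2 * (a ^ 4 - 4 * b * u ^ 4) / (64 * u ^ 6)"
    by (simp add: power_divide power_mult_distrib)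
  also have "\<dots> = (a\<^sup>2 / (4 * u\<^sup>2)) ^ 3 - b / 4 * (a\<^sup>2 / (4 * u\<^sup>2))"
    using u_nonzero by (simp add: power_divide power_mult_distrib field_simps)
  also have "b / 4 = (real n)\<^sup>2" unfolding n_eq b_def by Groebner_Basis.algebra
  finally show ?thesis unfolding point_coords_eq a_def b_def u_def .
qed

lemma P_x_pos: "P_x > 0"
proof -
  have "t ^ 4 + 6 * t\<^sup>2 + 1 > 0" by (simp add: add_nonneg_pos)
  then show ?thesis unfolding point_coords_eq using one_minus_square_nonzero by simp
qed

lemma point_ratio_eq: "real n / P_x = parameter_ratio t"
  unfolding point_coords_eq parameter_ratio_def unfolding n_eq
  by (simp add: power3_eq_cube power2_eq_square algebra_simps)

lemma parameter_ratio_nonzero: "parameter_ratio t \<noteq> 0"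
  unfolding point_ratio_eq[symmetric] using n_pos P_x_pos by simp

lemma inj_funpow_double_ratio_point: "inj (\<lambda>k. (double_ratio ^^ k) (real n / P_x))"
proof -
  obtain V :: "real set" where "valuation_ring V" "inverse 2 \<notin> V"
    using chevalley_extension[OF subring_Ints _ half_notin_Ints] by auto
  then interpret dyadic_valuation_ring V
    by (intro dyadic_valuation_ring.intro dyadic_valuation_ring_axioms.intro)
  obtain c where "c \<in> V" and ratio_even: "parameter_ratio t = 2 * c"
    using obtain_parameter_ratio_even[OF not_4_dvd n_eq] by blast
  moreover have "c \<noteq> 0" using ratio_even parameter_ratio_nonzero by auto
  ultimately show ?thesis
    unfolding point_ratio_eq ratio_even by (intro inj_funpow_double_ratio)
qed

lemma injective_doubling_point:
  assumes subfield: "subfield K real_ring" and "- t\<^sup>2 / 2 \<in> K"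
  shows "injective_doubling K (real n) P_x P_y"
proof -
  interpret subfield_of_field K by (rule subfield_of_field.intro[OF subfield])
  have "real n \<in> K" by (rule of_nat_mem)
  moreover have "P_x \<in> K" "P_y \<in> K"
    unfolding x_coord_def y_coord_def by (intro field_mem_intros assms(2))+
  ultimately show ?thesis
    using on_curve P_x_pos n_pos inj_funpow_double_ratio_point
    by (intro injective_doubling.intro injective_doubling_axioms.intro subfield_of_field_axioms) auto
qed

end

lemma cubic_root_field:
  assumes "n > 0" and not_4_dvd: "\<not> 4 dvd n" and root: "cubic_root n l"
  shows "real_cubic_field (rat_adjoin l)"
    and "infinite_order_in (congruent_curve n (rat_adjoin l))
      (Some (x_coord (real n) l, y_coord (real n) l))"
    and "infinite (congruent_solutions (rat_adjoin l) n)"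
proof -
  obtain t where n_eq: "real n = 2 * t ^ 3 + 2 * t" and l_eq: "l = - t\<^sup>2 / 2"
    using root unfolding cubic_root_iff[OF \<open>n > 0\<close>] by blast
  interpret parametrized_congruent_curve t n
    using not_4_dvd n_eq by unfold_locales
  have "injective_doubling (rat_adjoin l) (real n) (x_coord (real n) l) (y_coord (real n) l)"
    unfolding l_eq by (intro injective_doubling_point subfield_rat_adjoin self_mem_rat_adjoin)
  then interpret injective_doubling "rat_adjoin l" "real n" "x_coord (real n) l" "y_coord (real n) l" .
  have E_eq: "E = congruent_curve n (rat_adjoin l)" by (simp add: congruent_curve_def)
  show "real_cubic_field (rat_adjoin l)" unfolding l_eq by (rule real_cubic_field_root)
  show "infinite_order_in (congruent_curve n (rat_adjoin l))
      (Some (x_coord (real n) l, y_coord (real n) l))"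
    using infinite_order unfolding E_eq .
  show "infinite (congruent_solutions (rat_adjoin l) n)"
    using infinite_congruent_solutions[OF subfield \<open>n > 0\<close>] infinite_carrier unfolding E_eq by blast
qed

section \<open>Congruent numbers over real cubic fields\<close>

lemma properly_congruent_over_iff:
  "properly_congruent_over K n \<longleftrightarrow> infinite (congruent_solutions K n)"
proof -
  have "congruent_over K n" if "infinite (congruent_solutions K n)"
    using infinite_imp_nonempty[OF that] by (auto simp: congruent_solutions_def congruent_over_def)
  then show ?thesis by (auto simp: properly_congruent_over_def)
qed

lemma infinite_congruent_solutions_mult_square:
  fixes K :: "'a::field_char_0 set"
  assumes subring: "subring K ring_of_type_algebra" and "m > 0"
    and infinite: "infinite (congruent_solutions K n)"
  shows "infinite (congruent_solutions K (m\<^sup>2 * n))"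
proof -
  interpret subring_of_field K by (rule subring_of_field.intro[OF subring])
  define g :: "'a \<times> 'a \<times> 'a \<Rightarrow> 'a \<times> 'a \<times> 'a"
    where "g = (\<lambda>(a, b, c). (of_nat m * a, of_nat m * b, of_nat m * c))"
  have "inj g" using \<open>m > 0\<close> by (auto simp: g_def inj_def)
  then have "infinite (g ` congruent_solutions K n)"
    using infinite finite_imageD inj_on_subset by blast
  moreover have "g ` congruent_solutions K n \<subseteq> congruent_solutions K (m\<^sup>2 * n)"
    by (auto simp: g_def congruent_solutions_def power_mult_distrib mult_mem of_nat_mem
        power2_eq_square[of "of_nat m"] simp flip: distrib_left)
  ultimately show ?thesis using finite_subset by blast
qed

lemma properly_congruent_over_cubic_field:
  assumes "n > 0"
  shows "\<exists>K. real_cubic_field K \<and> properly_congruent_over K n"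
  using assms
proof (induction n rule: less_induct)
  case (less n)
  show ?case
  proof (cases "4 dvd n")
    case True
    then obtain m where n_eq: "n = 2\<^sup>2 * m" by auto
    then obtain K where K_field: "real_cubic_field K" "infinite (congruent_solutions K m)"
      using less.IH[of m] less.prems by (auto simp: properly_congruent_over_iff)
    then have "subring K real_ring" by (simp add: real_cubic_field_def subfieldE(1))
    then show ?thesis
      using K_field infinite_congruent_solutions_mult_square[of K 2 m] unfolding n_eq
      by (auto simp: properly_congruent_over_iff)
  next
    case False
    then show ?thesis
      using cubic_root_field[OF less.prems False] cubic_root_ex1[OF less.prems]
      by (auto simp: properly_congruent_over_iff)
  qed
qed

lemma squarefree_not_4_dvd:
  assumes "squarefree (n::nat)"
  shows "\<not> 4 dvd n"
  using assms squarefreeD[of n 2] by auto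

theorem theorem3:
  shows "(\<forall>n::nat. n > 0 \<longrightarrow>
            (\<exists>K::real set. real_cubic_field K \<and> properly_congruent_over K n)) \<and>
         (\<forall>n::nat. n > 0 \<longrightarrow> squarefree n \<longrightarrow>
            (\<exists>!l::real. cubic_root n l) \<and>
            (\<forall>l::real. cubic_root n l \<longrightarrow>
               real_cubic_field (rat_adjoin l) \<and>
               infinite_order_in (congruent_curve n (rat_adjoin l))
                 (Some (x_coord (real n) l, y_coord (real n) l))))"
  using properly_congruent_over_cubic_field cubic_root_ex1
    cubic_root_field(1,2)[OF _ squarefree_not_4_dvd]
  by simp

end
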